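(* Let $\alpha\in\mathbb{R}$, $\alpha\neq0$, and let $\Sigma\subset\mathbb{R}^3$ be a $K^\alpha$-translator with speed $\vec{v}=(0,0,1)$. If $\Sigma$ is a helicoidal surface about the $z$-axis with pitch $h$, then $\Sigma$ is parametrized by $$X(r,\theta)=(r\cos\theta,r\sin\theta,f(r)+h\theta),\quad r\in I\subset(0,\infty),\ \theta\in\mathbb{R},$$ where $$f(r)=\begin{cases}\pm\displaystyle\int^{r}\left(me^{t^2}-\frac{h^2}{t^2}-1\right)^{1/2}dt,\quad m>0, & \alpha=\frac12,\\[2mm] \pm\displaystyle\int^{r}\left(\left(\frac{1-2\alpha}{2\alpha}t^2+m\right)^{\frac{2\alpha}{1-2\alpha}}-\frac{h^2}{t^2}-1\right)^{1/2}dt,\quad m\in\mathbb{R}, & \alpha\neq\frac12.\end{cases}$$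
   Context: Let $\alpha\in\mathbb{R}$, $\alpha\ne 0$, and let $\vec{v}\in\mathbb{R}^3$ be a unit vector. A smooth surface $\Sigma$ in Euclidean space $\mathbb{R}^3$ with unit normal $N$ and Gauss curvature $K$ is called a $K^\alpha$-translator with speed $\vec{v}$ if $K^\alpha=\langle N,\vec{v}\rangle$ on $\Sigma$. The surface is not required to have $K>0$; it is implicitly assumed that $K^\alpha$ makes sense (for example, $K$ may be negative if $\alpha\in\mathbb{Z}$). Planes and surfaces of constant Gauss curvature are discarded throughout. A helicoidal surface about the $z$-axis with pitch $h\neq0$ is a surface invariant under the uniparametric group of helicoidal motions with axis the $z$-axis and pitch $h$; its generating curve in the $xz$-plane is taken as a graph $\gamma(r)=(r,0,f(r))$ with $f\colon I\subset(0,\infty)\to\mathbb{R}$ smooth. The symbol $\int^r$ denotes an indefinite integral (antiderivative in $r$, determined up to an additive constant), and $m$ is a constant of integration; the domain $I$ is restricted so that the radicand is nonnegative.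
   Formalization: The sign ± is one constant on I if α>0 or K>0; for α<0 with K<0 it is only constant on intervals where the radicand is positive and may change at its zeros, since a single global sign fails there (e.g. α=-1, h²=5r₀², r₀²=5·6^(-5/2)). *)

theory Defs
  imports "HOL-Analysis.Analysis"
begin

section \<open>Real powers\<close>

text \<open>
  The power \<open>x^a\<close> of a real number by a real exponent makes sense for \<open>x > 0\<close>, for \<open>x = 0\<close> and
  \<open>a > 0\<close>, and for \<open>x < 0\<close> when \<open>a\<close> is a fraction \<open>p/q\<close> with \<open>q\<close> odd (in particular, an integer);
  in the last case it is the real number \<open>(-1)^p \<bar>x\<bar>^a\<close>.  The parity of \<open>p\<close> does not depend on the
  representation of \<open>a\<close> with odd denominator.
\<close>

definition odd_denominator :: "real \<Rightarrow> bool" where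
  "odd_denominator a \<longleftrightarrow> (\<exists>p q :: int. odd q \<and> a = of_int p / of_int q)"

definition real_pow_defined :: "real \<Rightarrow> real \<Rightarrow> bool" where
  "real_pow_defined x a \<longleftrightarrow> x > 0 \<or> (x = 0 \<and> a > 0) \<or> (x < 0 \<and> odd_denominator a)"

definition real_pow :: "real \<Rightarrow> real \<Rightarrow> real" where
  "real_pow x a =
     (if x \<ge> 0 then x powr a
      else if \<exists>p q :: int. even p \<and> odd q \<and> a = of_int p / of_int q then \<bar>x\<bar> powr a
      else - (\<bar>x\<bar> powr a))"

section \<open>Smooth maps\<close>

text \<open>\<open>C\<^sup>k\<close> and \<open>C\<^sup>\<infinity>\<close> maps; to be used on open sets only.\<close>

fun Ck_on :: "nat \<Rightarrow> 'a::real_normed_vector set \<Rightarrow> ('a \<Rightarrow> 'b::real_normed_vector) \<Rightarrow> bool" where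
  "Ck_on 0 S f \<longleftrightarrow> continuous_on S f"
| "Ck_on (Suc k) S f \<longleftrightarrow>
     (\<forall>x\<in>S. f differentiable (at x)) \<and> (\<forall>v. Ck_on k S (\<lambda>x. frechet_derivative f (at x) v))"

definition smooth_on :: "'a::real_normed_vector set \<Rightarrow> ('a \<Rightarrow> 'b::real_normed_vector) \<Rightarrow> bool" where
  "smooth_on S f \<longleftrightarrow> (\<forall>k. Ck_on k S f)"

text \<open>Smoothness on an arbitrary subset: locally the restriction of a smooth map of the ambient space.\<close>

definition smooth_map_on :: "'a::real_normed_vector set \<Rightarrow> ('a \<Rightarrow> 'b::real_normed_vector) \<Rightarrow> bool" where
  "smooth_map_on S f \<longleftrightarrow>
     (\<forall>x\<in>S. \<exists>V g. open V \<and> x \<in> V \<and> smooth_on V g \<and> (\<forall>y\<in>V \<inter> S. g y = f y))"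

section \<open>Surfaces in Euclidean space\<close>

definition regular_parametrization :: "(real \<times> real) set \<Rightarrow> (real \<times> real \<Rightarrow> real ^ 3) \<Rightarrow> bool" where
  "regular_parametrization U X \<longleftrightarrow>
     open U \<and> smooth_on U X \<and> (\<forall>q\<in>U. inj (frechet_derivative X (at q)))"

definition regular_surface :: "(real ^ 3) set \<Rightarrow> bool" where
  "regular_surface \<Sigma> \<longleftrightarrow>
     (\<forall>p\<in>\<Sigma>. \<exists>V U X Y. open V \<and> p \<in> V \<and> regular_parametrization U X \<and>
        homeomorphism U (\<Sigma> \<inter> V) X Y)"

definition tangent_space :: "(real ^ 3) set \<Rightarrow> real ^ 3 \<Rightarrow> (real ^ 3) set" where
  "tangent_space \<Sigma> p =
     {w. \<exists>c e. e > 0 \<and> smooth_on {-e<..<e} c \<and> c ` {-e<..<e} \<subseteq> \<Sigma> \<and> c 0 = p \<and>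
         (c has_vector_derivative w) (at (0::real))}"

definition unit_normal_field :: "(real ^ 3) set \<Rightarrow> (real ^ 3 \<Rightarrow> real ^ 3) \<Rightarrow> bool" where
  "unit_normal_field \<Sigma> N \<longleftrightarrow>
     smooth_map_on \<Sigma> N \<and>
     (\<forall>p\<in>\<Sigma>. norm (N p) = 1 \<and> (\<forall>w\<in>tangent_space \<Sigma> p. N p \<bullet> w = 0))"

text \<open>
  The Gauss curvature at \<open>p\<close> is the determinant of the differential \<open>dN\<^sub>p\<close> of the Gauss map, an
  endomorphism of the tangent plane.  A derivative \<open>L\<close> of \<open>N\<close> within \<open>\<Sigma>\<close> is only determined on the
  tangent plane, where it is \<open>dN\<^sub>p\<close>; the determinant is read off its matrix in a basis \<open>w1, w2\<close>.
\<close>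

definition gauss_curvature ::
    "(real ^ 3) set \<Rightarrow> (real ^ 3 \<Rightarrow> real ^ 3) \<Rightarrow> real ^ 3 \<Rightarrow> real" where
  "gauss_curvature \<Sigma> N p =
     (THE k. \<exists>L w1 w2 a b c d.
        (N has_derivative L) (at p within \<Sigma>) \<and>
        w1 \<noteq> w2 \<and> independent {w1, w2} \<and> span {w1, w2} = tangent_space \<Sigma> p \<and>
        L w1 = a *\<^sub>R w1 + b *\<^sub>R w2 \<and> L w2 = c *\<^sub>R w1 + d *\<^sub>R w2 \<and>
        k = a * d - b * c)"

definition K_translator ::
    "real \<Rightarrow> real ^ 3 \<Rightarrow> (real ^ 3) set \<Rightarrow> (real ^ 3 \<Rightarrow> real ^ 3) \<Rightarrow> bool" where
  "K_translator \<alpha> v \<Sigma> N \<longleftrightarrow>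
     norm v = 1 \<and> regular_surface \<Sigma> \<and> unit_normal_field \<Sigma> N \<and>
     (\<forall>p\<in>\<Sigma>. real_pow_defined (gauss_curvature \<Sigma> N p) \<alpha> \<and>
             real_pow (gauss_curvature \<Sigma> N p) \<alpha> = N p \<bullet> v)"

section \<open>Helicoidal surfaces about the z-axis\<close>

definition helicoidal_motion :: "real \<Rightarrow> real \<Rightarrow> real ^ 3 \<Rightarrow> real ^ 3" where
  "helicoidal_motion h s p =
     vector [p $ 1 * cos s - p $ 2 * sin s, p $ 1 * sin s + p $ 2 * cos s, p $ 3 + h * s]"

text \<open>The surface is swept out by the curve \<open>r \<mapsto> (r, 0, f r)\<close>, \<open>r \<in> I\<close>, of the xz-plane.\<close>

definition helicoidal_surface ::
    "real \<Rightarrow> real set \<Rightarrow> (real \<Rightarrow> real) \<Rightarrow> (real ^ 3) set \<Rightarrow> bool" where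
  "helicoidal_surface h I f \<Sigma> \<longleftrightarrow>
     (\<forall>s. helicoidal_motion h s ` \<Sigma> = \<Sigma>) \<and>
     (\<forall>r\<in>I. vector [r, 0, f r] \<in> \<Sigma>) \<and>
     (\<forall>p\<in>\<Sigma>. \<exists>s. \<exists>r\<in>I. p = helicoidal_motion h s (vector [r, 0, f r]))"

section \<open>Signed indefinite integrals\<close>

definition indefinite_integral_on :: "real set \<Rightarrow> (real \<Rightarrow> real) \<Rightarrow> (real \<Rightarrow> real) \<Rightarrow> bool" where
  "indefinite_integral_on I g F \<longleftrightarrow> (\<forall>t\<in>I. (F has_real_derivative g t) (at t))"

text \<open>
  Choice of the sign \<open>\<plusminus>\<close> in front of \<open>sqrt R\<close>: it can change only across a zero of \<open>R\<close>.
\<close>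

definition sign_choice :: "real set \<Rightarrow> (real \<Rightarrow> real) \<Rightarrow> (real \<Rightarrow> real) \<Rightarrow> bool" where
  "sign_choice I R \<sigma> \<longleftrightarrow>
     (\<forall>t\<in>I. \<sigma> t = 1 \<or> \<sigma> t = -1) \<and>
     (\<forall>J\<subseteq>I. is_interval J \<and> (\<forall>t\<in>J. R t > 0) \<longrightarrow> \<sigma> constant_on J)"

definition radicand :: "real \<Rightarrow> real \<Rightarrow> real \<Rightarrow> real \<Rightarrow> real" where
  "radicand \<alpha> h m t =
     (if \<alpha> = 1/2 then m * exp (t\<^sup>2)
      else real_pow ((1 - 2 * \<alpha>) / (2 * \<alpha>) * t\<^sup>2 + m) (2 * \<alpha> / (1 - 2 * \<alpha>)))
     - h\<^sup>2 / t\<^sup>2 - 1"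

end

theory Submission
  imports Defs "HOL-Analysis.Cross3"
begin

text \<open>
  In the parametrization \<open>X(r, \<theta>) = (r cos \<theta>, r sin \<theta>, f(r) + h \<theta>)\<close> the cross product
  \<open>n = X\<^sub>r \<times> X\<^sub>\<theta>\<close> has third component \<open>r\<close> and length \<open>W = sqrt (r\<^sup>2 + h\<^sup>2 + r\<^sup>2 f'\<^sup>2)\<close>.  Hence
  \<open>\<bar>\<langle>N, v\<rangle>\<bar> = r / W\<close>, which never vanishes, and the Gauss curvature is
  \<open>K = (r\<^sup>3 f' f'' - h\<^sup>2) / W\<^sup>4\<close>.  Everything follows from the single function
  \<open>u = W\<^sup>2 / r\<^sup>2 = 1 + h\<^sup>2 / r\<^sup>2 + f'\<^sup>2\<close>, since \<open>u' = 2 r K u\<^sup>2\<close> and the translator equation says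
  \<open>\<bar>K\<bar> = u powr (- 1 / (2\<alpha>))\<close>: the profile satisfies the separable equation
  \<open>u' = 2 r \<delta> u powr (2 - 1 / (2\<alpha>))\<close>, where \<open>\<delta>\<close> is the sign of \<open>K\<close> (lemma \<open>speed_ode\<close>).  As \<open>K\<close> has
  no zero, \<open>\<delta>\<close> is constant.

  Integration gives \<open>u = m exp (r\<^sup>2)\<close> for \<open>\<alpha> = 1/2\<close>, and otherwise
  \<open>u powr \<beta> = \<delta> \<beta> r\<^sup>2 + c\<close> with \<open>\<beta> = (1 - 2\<alpha>) / (2\<alpha>)\<close>.  For \<open>\<delta> = 1\<close> this is the asserted formula with
  \<open>m = c\<close>.  For \<open>\<delta> = -1\<close> and \<open>m = -c\<close> the base \<open>\<beta> r\<^sup>2 + m = - u powr \<beta>\<close> is negative; but a negative \<open>K\<close>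
  forces \<open>\<alpha>\<close> to be a fraction with odd denominator, and then \<open>1 / \<beta>\<close> is a fraction with even numerator
  and odd denominator, so that the formula holds again (lemma \<open>real_pow_signed_inverse\<close>).  In particular
  \<open>\<alpha> = 1/2\<close> leaves only \<open>\<delta> = 1\<close>.

  The radicand is thus \<open>f'\<^sup>2\<close>, and the sign in front of its root is the sign of \<open>f'\<close>, which can change
  only at a zero of \<open>f'\<close>.  If \<open>K > 0\<close> there is none, because \<open>r\<^sup>3 f' f'' > h\<^sup>2\<close>; if \<open>K < 0\<close> and
  \<open>\<alpha> > 0\<close>, differentiating the equation for \<open>u\<close> once more at a zero of \<open>f'\<close> contradicts \<open>f''\<^sup>2 \<ge> 0\<close>
  (lemma \<open>no_horizontal_tangent\<close>).

  The geometric input is made elementary by a global inverse of \<open>X\<close>: on the surface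
  \<open>r = sqrt (x\<^sup>2 + y\<^sup>2)\<close> and \<open>\<theta> = (z - f(r)) / h\<close>.  It turns every curve in the surface into a curve in the
  parameter domain and identifies the tangent planes (lemma \<open>tangent_space_helicoid\<close>).
\<close>

section \<open>Calculus of differentiability classes\<close>

text \<open>
  The Frechet derivative of a function that agrees with \<open>f\<close> only on the open set \<open>S\<close> is that of \<open>f\<close>
  at the points of \<open>S\<close>; this is what allows any formula for the derivative in \<open>Ck_on_SucI\<close>.
\<close>

lemma Ck_on_cong:
  assumes "open S" "Ck_on k S f" "\<And>x. x \<in> S \<Longrightarrow> f x = g x"
  shows "Ck_on k S g"
  using assms(2,3)
proof (induction k arbitrary: f g)
  case 0
  then show ?case by (simp cong: continuous_on_cong)
next
  case (Suc k)
  have der: "(g has_derivative frechet_derivative f (at x)) (at x)" if "x \<in> S" for x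
    using Suc.prems that \<open>open S\<close>
    by (auto intro!: has_derivative_transform_within_open[of f _ x _ S g]
        simp: frechet_derivative_works)
  have "Ck_on k S (\<lambda>x. frechet_derivative g (at x) v)" for v
  proof (rule Suc.IH)
    show "Ck_on k S (\<lambda>x. frechet_derivative f (at x) v)"
      using Suc.prems(1) by simp
    show "frechet_derivative f (at x) v = frechet_derivative g (at x) v" if "x \<in> S" for x
      using frechet_derivative_at[OF der[OF that]] by simp
  qed
  then show ?case
    using der by (auto simp: differentiable_def)
qed

lemma Ck_on_SucI:
  assumes "open S" and der: "\<And>x. x \<in> S \<Longrightarrow> (f has_derivative f' x) (at x)"
    and Ck: "\<And>v. Ck_on k S (\<lambda>x. f' x v)"
  shows "Ck_on (Suc k) S f"
proof -
  have "Ck_on k S (\<lambda>x. frechet_derivative f (at x) v)" for v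
    using frechet_derivative_at[OF der] by (intro Ck_on_cong[OF \<open>open S\<close> Ck[of v]]) simp
  then show ?thesis
    using der by (auto simp: differentiable_def)
qed

lemma Ck_on_SucD:
  assumes "Ck_on (Suc k) S f" "x \<in> S"
  shows "(f has_derivative frechet_derivative f (at x)) (at x)"
  using assms by (simp add: frechet_derivative_works)

lemma Ck_on_SucE:
  assumes "Ck_on (Suc k) S f"
  shows "Ck_on k S f"
  using assms
proof (induction k arbitrary: f)
  case 0
  then have "f differentiable_on S"
    by (simp add: differentiable_on_def differentiable_at_withinI)
  then show ?case
    by (simp add: differentiable_imp_continuous_on)
next
  case (Suc k)
  have "f differentiable (at x)" if "x \<in> S" for x
    using Suc.prems that by simp
  moreover have "Ck_on (Suc k) S (\<lambda>x. frechet_derivative f (at x) v)" for v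
    using Suc.prems unfolding Ck_on.simps(2)[of "Suc k" S f] by simp
  then have "Ck_on k S (\<lambda>x. frechet_derivative f (at x) v)" for v
    by (rule Suc.IH)
  ultimately show ?case
    by simp
qed

lemma Ck_on_const: "open S \<Longrightarrow> Ck_on k S (\<lambda>x. c)"
proof (induction k arbitrary: c)
  case (Suc k)
  show ?case
    by (rule Ck_on_SucI[where f' = "\<lambda>_ _. 0"]) (use Suc in auto)
qed simp

lemma Ck_on_bounded_linear:
  assumes "bounded_linear L" "open S"
  shows "Ck_on k S L"
proof (cases k)
  case 0
  then show ?thesis
    using assms by (simp add: linear_continuous_on)
next
  case (Suc j)
  show ?thesis
    unfolding Suc
    by (rule Ck_on_SucI[where f' = "\<lambda>_. L"])
       (use assms in \<open>auto intro: bounded_linear_imp_has_derivative Ck_on_const\<close>)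
qed

lemma Ck_on_add:
  assumes "open S" "Ck_on k S f" "Ck_on k S g"
  shows "Ck_on k S (\<lambda>x. f x + g x)"
  using assms(2,3)
proof (induction k arbitrary: f g)
  case 0
  then show ?case by (simp add: continuous_on_add)
next
  case (Suc k)
  show ?case
  proof (rule Ck_on_SucI[where f' = "\<lambda>x v. frechet_derivative f (at x) v + frechet_derivative g (at x) v"])
    show "((\<lambda>x. f x + g x) has_derivative
        (\<lambda>v. frechet_derivative f (at x) v + frechet_derivative g (at x) v)) (at x)" if "x \<in> S" for x
      by (intro has_derivative_add Ck_on_SucD[OF Suc.prems(1) that] Ck_on_SucD[OF Suc.prems(2) that])
  qed (use Suc \<open>open S\<close> in auto)
qed

lemma Ck_on_mult:
  fixes f g :: "'a::real_normed_vector \<Rightarrow> real"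
  assumes "open S" "Ck_on k S f" "Ck_on k S g"
  shows "Ck_on k S (\<lambda>x. f x * g x)"
  using assms(2,3)
proof (induction k arbitrary: f g)
  case 0
  then show ?case by (simp add: continuous_on_mult)
next
  case (Suc k)
  show ?case
  proof (rule Ck_on_SucI[where f' = "\<lambda>x v. f x * frechet_derivative g (at x) v
                                        + frechet_derivative f (at x) v * g x"])
    show "Ck_on k S (\<lambda>x. f x * frechet_derivative g (at x) v + frechet_derivative f (at x) v * g x)" for v
      using Suc.prems Ck_on_SucE[OF Suc.prems(1)] Ck_on_SucE[OF Suc.prems(2)] \<open>open S\<close>
      by (intro Ck_on_add Suc.IH) auto
    show "((\<lambda>x. f x * g x) has_derivative
        (\<lambda>v. f x * frechet_derivative g (at x) v + frechet_derivative f (at x) v * g x)) (at x)"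
      if "x \<in> S" for x
      by (intro has_derivative_mult Ck_on_SucD[OF Suc.prems(1) that] Ck_on_SucD[OF Suc.prems(2) that])
  qed (fact \<open>open S\<close>)
qed

lemma Ck_on_linear_compose:
  assumes "bounded_linear L" "open S" "Ck_on k S f"
  shows "Ck_on k S (\<lambda>x. L (f x))"
  using assms(3)
proof (induction k arbitrary: f)
  case 0
  then show ?case by (simp add: bounded_linear.continuous_on[OF assms(1)])
next
  case (Suc k)
  show ?case
  proof (rule Ck_on_SucI[where f' = "\<lambda>x v. L (frechet_derivative f (at x) v)"])
    show "((\<lambda>x. L (f x)) has_derivative (\<lambda>v. L (frechet_derivative f (at x) v))) (at x)"
      if "x \<in> S" for x
      by (intro bounded_linear.has_derivative[OF assms(1)] Ck_on_SucD[OF Suc.prems that])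
  qed (use Suc assms(2) in auto)
qed

lemma linear_times_1:
  fixes L :: "real \<Rightarrow> real"
  assumes "linear L"
  shows "L = (*) (L 1)" and "(\<lambda>v. L (M v)) = (\<lambda>v. L 1 * M v)"
proof -
  have *: "L x = L 1 * x" for x
    using linear_cmul[OF assms, of x 1] by (metis mult.commute mult.right_neutral real_scaleR_def)
  show "L = (*) (L 1)" by (rule ext) (rule *)
  show "(\<lambda>v. L (M v)) = (\<lambda>v. L 1 * M v)" by (rule ext) (rule *)
qed

lemma Ck_on_compose:
  fixes g :: "real \<Rightarrow> real"
  assumes "open S" "Ck_on k S f" "Ck_on k T g" "f ` S \<subseteq> T"
  shows "Ck_on k S (\<lambda>x. g (f x))"
  using assms(2,3)
proof (induction k arbitrary: g)
  case 0
  then show ?case using assms(4) by (auto intro: continuous_on_compose2)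
next
  case (Suc k)
  show ?case
  proof (rule Ck_on_SucI[where f' = "\<lambda>x v. frechet_derivative g (at (f x)) 1 * frechet_derivative f (at x) v"])
    fix x assume "x \<in> S"
    then have "f x \<in> T" using assms(4) by auto
    have g: "(g has_derivative frechet_derivative g (at (f x))) (at (f x))"
      by (rule Ck_on_SucD[OF Suc.prems(2) \<open>f x \<in> T\<close>])
    have "(\<lambda>v. frechet_derivative g (at (f x)) (frechet_derivative f (at x) v))
        = (\<lambda>v. frechet_derivative g (at (f x)) 1 * frechet_derivative f (at x) v)"
      using linear_times_1[OF has_derivative_linear[OF g]] by blast
    with has_derivative_compose[OF Ck_on_SucD[OF Suc.prems(1) \<open>x \<in> S\<close>] g]
    show "((\<lambda>x. g (f x)) has_derivative
        (\<lambda>v. frechet_derivative g (at (f x)) 1 * frechet_derivative f (at x) v)) (at x)"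
      by (rule back_subst)
  next
    fix v
    have "Ck_on k T (\<lambda>y. frechet_derivative g (at y) 1)"
      using Suc.prems(2) by simp
    then have "Ck_on k S (\<lambda>x. frechet_derivative g (at (f x)) 1)"
      by (rule Suc.IH[OF Ck_on_SucE[OF Suc.prems(1)]])
    moreover have "Ck_on k S (\<lambda>x. frechet_derivative f (at x) v)"
      using Suc.prems(1) by simp
    ultimately show "Ck_on k S (\<lambda>x. frechet_derivative g (at (f x)) 1 * frechet_derivative f (at x) v)"
      by (rule Ck_on_mult[OF \<open>open S\<close>])
  qed (fact \<open>open S\<close>)
qed

lemma Ck_on_sin_cos: "Ck_on k UNIV (sin :: real \<Rightarrow> real) \<and> Ck_on k UNIV (cos :: real \<Rightarrow> real)"
proof (induction k)
  case 0
  then show ?case by (auto intro: continuous_intros)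
next
  case (Suc k)
  have neg: "Ck_on k UNIV (\<lambda>x::real. - sin x)"
    using Ck_on_linear_compose[OF bounded_linear_minus[OF bounded_linear_ident]] Suc by auto
  have "Ck_on (Suc k) UNIV (sin :: real \<Rightarrow> real)"
  proof (rule Ck_on_SucI[where f' = "\<lambda>x v. cos x * v"])
    show "(sin has_derivative (\<lambda>v. cos x * v)) (at x)" for x :: real
      using DERIV_sin by (simp add: has_field_derivative_def)
    show "Ck_on k UNIV (\<lambda>x. cos x * v)" for v :: real
      using Suc by (intro Ck_on_mult Ck_on_const open_UNIV) auto
  qed simp
  moreover have "Ck_on (Suc k) UNIV (cos :: real \<Rightarrow> real)"
  proof (rule Ck_on_SucI[where f' = "\<lambda>x v. (- sin x) * v"])
    show "(cos has_derivative (\<lambda>v. (- sin x) * v)) (at x)" for x :: real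
      using DERIV_cos[of x] unfolding has_field_derivative_def .
    show "Ck_on k UNIV (\<lambda>x. (- sin x) * v)" for v :: real
      by (intro Ck_on_mult Ck_on_const neg open_UNIV)
  qed simp
  ultimately show ?case by blast
qed

text \<open>
  The third derivative is needed for the continuity of the curvature and for differentiating the
  equation of the generating curve.
\<close>

lemma smooth_on_real_derivatives:
  fixes f :: "real \<Rightarrow> real"
  assumes "smooth_on I f"
  obtains f1 f2 f3 where
    "\<And>t. t \<in> I \<Longrightarrow> (f has_real_derivative f1 t) (at t)"
    "\<And>t. t \<in> I \<Longrightarrow> (f1 has_real_derivative f2 t) (at t)"
    "\<And>t. t \<in> I \<Longrightarrow> (f2 has_real_derivative f3 t) (at t)"
proof -
  define d :: "(real \<Rightarrow> real) \<Rightarrow> real \<Rightarrow> real" where "d g t = frechet_derivative g (at t) 1" for g t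
  have step: "\<forall>t\<in>I. (g has_real_derivative d g t) (at t)" "smooth_on I (d g)"
    if "smooth_on I g" for g
  proof -
    have *: "Ck_on (Suc k) I g" for k
      using that unfolding smooth_on_def by blast
    show "\<forall>t\<in>I. (g has_real_derivative d g t) (at t)"
    proof
      fix t assume "t \<in> I"
      note der = Ck_on_SucD[OF * this]
      have "frechet_derivative g (at t) = (*) (d g t)"
        unfolding d_def using linear_times_1[OF has_derivative_linear[OF der]] by blast
      then show "(g has_real_derivative d g t) (at t)"
        using der by (simp add: has_field_derivative_def)
    qed
    show "smooth_on I (d g)"
      using * by (simp add: smooth_on_def d_def[abs_def])
  qed
  show thesis
    using that[of "d f" "d (d f)" "d (d (d f))"] step assms by blast
qed

section \<open>The Gauss curvature from two tangent vectors\<close>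

unbundle cross3_syntax

lemma cross3_linear_combinations:
  "(a *\<^sub>R x + b *\<^sub>R y) \<times> (c *\<^sub>R x + d *\<^sub>R y) = (a * d - b * c) *\<^sub>R (x \<times> y)"
  by (simp add: vec_eq_iff forall_3 cross3_simps)

text \<open>
  Cramer's rule: for \<open>n = x \<times> y\<close> the coefficients are \<open>((w \<times> y) \<bullet> n) / (n \<bullet> n)\<close> and
  \<open>((x \<times> w) \<bullet> n) / (n \<bullet> n)\<close>.
\<close>

lemma orthogonal_cross3_decomposition:
  assumes "x \<times> y \<noteq> 0" "w \<bullet> (x \<times> y) = 0"
  shows "\<exists>a b. w = a *\<^sub>R x + b *\<^sub>R y"
proof -
  let ?n = "x \<times> y"
  let ?c = "?n \<bullet> ?n"
  have "?c *\<^sub>R w = ((w \<times> y) \<bullet> ?n) *\<^sub>R x + ((x \<times> w) \<bullet> ?n) *\<^sub>R y + (w \<bullet> ?n) *\<^sub>R ?n"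
    by (simp add: vec_eq_iff forall_3 inner_vec_def sum_3 cross3_def) algebra
  then have "?c *\<^sub>R w = ((w \<times> y) \<bullet> ?n) *\<^sub>R x + ((x \<times> w) \<bullet> ?n) *\<^sub>R y"
    using assms(2) by simp
  then have "inverse ?c *\<^sub>R (?c *\<^sub>R w)
      = inverse ?c *\<^sub>R (((w \<times> y) \<bullet> ?n) *\<^sub>R x + ((x \<times> w) \<bullet> ?n) *\<^sub>R y)"
    by (rule arg_cong)
  moreover have "?c \<noteq> 0" using assms(1) by simp
  ultimately have "w = (inverse ?c * ((w \<times> y) \<bullet> ?n)) *\<^sub>R x + (inverse ?c * ((x \<times> w) \<bullet> ?n)) *\<^sub>R y"
    by (simp add: scaleR_add_right)
  then show ?thesis by blast
qed

lemma span_two: "span {x, y} = {a *\<^sub>R x + b *\<^sub>R y | a b. True}" for x y :: "'a::real_vector"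
proof -
  have "z \<in> span {x, y} \<longleftrightarrow> (\<exists>a b. z = a *\<^sub>R x + b *\<^sub>R y)" for z
    unfolding span_insert span_singleton
    by (auto simp: algebra_simps)
  then show ?thesis by auto
qed

text \<open>
  An endomorphism \<open>L\<close> of a plane satisfies \<open>L w1 \<times> L w2 = det L \<cdot> (w1 \<times> w2)\<close> for every basis
  \<open>w1, w2\<close> of the plane.  Hence the determinant does not depend on the basis, and it can be computed from
  the images \<open>y1, y2\<close> of one basis \<open>x1, x2\<close> without finding the matrix of \<open>L\<close>.
\<close>

lemma gauss_curvature_eqI:
  fixes x1 x2 y1 y2 :: "real ^ 3"
  defines "n \<equiv> x1 \<times> x2"
  assumes tangent: "tangent_space \<Sigma> p = {a *\<^sub>R x1 + b *\<^sub>R x2 | a b. True}"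
    and "n \<noteq> 0"
    and ex: "\<exists>L. (N has_derivative L) (at p within \<Sigma>)"
    and L: "\<And>L. (N has_derivative L) (at p within \<Sigma>) \<Longrightarrow> L x1 = y1 \<and> L x2 = y2"
    and orth: "y1 \<bullet> n = 0" "y2 \<bullet> n = 0"
    and k: "(y1 \<times> y2) \<bullet> n = k * (n \<bullet> n)"
  shows "gauss_curvature \<Sigma> N p = k"
  unfolding gauss_curvature_def
proof (rule the_equality)
  obtain a b c d where y: "y1 = a *\<^sub>R x1 + b *\<^sub>R x2" "y2 = c *\<^sub>R x1 + d *\<^sub>R x2"
    using orthogonal_cross3_decomposition orth \<open>n \<noteq> 0\<close> unfolding n_def by metis
  have "n \<bullet> n \<noteq> 0" using \<open>n \<noteq> 0\<close> by simp
  have yy: "y1 \<times> y2 = (a * d - b * c) *\<^sub>R n"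
    unfolding y n_def by (rule cross3_linear_combinations)
  with k \<open>n \<bullet> n \<noteq> 0\<close> have k_eq: "k = a * d - b * c"
    by simp
  have "x1 \<notin> span {x2}"
    using \<open>n \<noteq> 0\<close> by (auto simp: span_singleton n_def cross_mult_left)
  moreover have "x2 \<noteq> 0" using \<open>n \<noteq> 0\<close> by (auto simp: n_def)
  ultimately have "x1 \<noteq> x2" "independent {x1, x2}"
    by (auto simp: independent_insert dependent_single span_base)
  with L ex y k_eq show "\<exists>L w1 w2 a b c d. (N has_derivative L) (at p within \<Sigma>) \<and>
      w1 \<noteq> w2 \<and> independent {w1, w2} \<and> span {w1, w2} = tangent_space \<Sigma> p \<and>
      L w1 = a *\<^sub>R w1 + b *\<^sub>R w2 \<and> L w2 = c *\<^sub>R w1 + d *\<^sub>R w2 \<and> k = a * d - b * c"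
    unfolding tangent span_two by blast

  fix k'
  assume "\<exists>L w1 w2 a b c d. (N has_derivative L) (at p within \<Sigma>) \<and>
      w1 \<noteq> w2 \<and> independent {w1, w2} \<and> span {w1, w2} = tangent_space \<Sigma> p \<and>
      L w1 = a *\<^sub>R w1 + b *\<^sub>R w2 \<and> L w2 = c *\<^sub>R w1 + d *\<^sub>R w2 \<and> k' = a * d - b * c"
  then obtain L w1 w2 a' b' c' d' where der: "(N has_derivative L) (at p within \<Sigma>)"
    and span: "span {w1, w2} = tangent_space \<Sigma> p"
    and Lw: "L w1 = a' *\<^sub>R w1 + b' *\<^sub>R w2" "L w2 = c' *\<^sub>R w1 + d' *\<^sub>R w2"
    and k': "k' = a' * d' - b' * c'"
    by blast
  have Ly: "L x1 = y1" "L x2 = y2" using L[OF der] by auto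
  interpret L: linear L by (rule has_derivative_linear[OF der])
  have "w1 \<in> tangent_space \<Sigma> p" "w2 \<in> tangent_space \<Sigma> p"
    unfolding span[symmetric] by (auto intro: span_base)
  then obtain t u v w where w12: "w1 = t *\<^sub>R x1 + u *\<^sub>R x2" "w2 = v *\<^sub>R x1 + w *\<^sub>R x2"
    unfolding tangent by blast
  have "x1 = 1 *\<^sub>R x1 + 0 *\<^sub>R x2" "x2 = 0 *\<^sub>R x1 + 1 *\<^sub>R x2" by auto
  then have "x1 \<in> span {w1, w2}" "x2 \<in> span {w1, w2}"
    unfolding span tangent by blast+
  then obtain t' u' v' w' where x12: "x1 = t' *\<^sub>R w1 + u' *\<^sub>R w2" "x2 = v' *\<^sub>R w1 + w' *\<^sub>R w2"
    unfolding span_two by blast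
  have ww: "w1 \<times> w2 = (t * w - u * v) *\<^sub>R n"
    unfolding w12 n_def by (rule cross3_linear_combinations)
  have "n = (t' * w' - u' * v') *\<^sub>R (w1 \<times> w2)"
    unfolding n_def by (subst (1) x12(1), subst (1) x12(2)) (rule cross3_linear_combinations)
  then have "t * w - u * v \<noteq> 0"
    using \<open>n \<noteq> 0\<close> ww by auto
  have "L w1 \<times> L w2 = (t * w - u * v) *\<^sub>R (y1 \<times> y2)"
    unfolding w12 by (simp only: L.add L.scaleR Ly cross3_linear_combinations)
  also have "\<dots> = (t * w - u * v) *\<^sub>R (k *\<^sub>R n)"
    by (simp add: yy k_eq)
  finally have "(t * w - u * v) *\<^sub>R (k *\<^sub>R n) = k' *\<^sub>R ((t * w - u * v) *\<^sub>R n)"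
    unfolding Lw cross3_linear_combinations k'[symmetric] ww by auto
  then have "((t * w - u * v) * (k - k')) *\<^sub>R n = 0"
    by (simp add: algebra_simps)
  with \<open>t * w - u * v \<noteq> 0\<close> \<open>n \<noteq> 0\<close> show "k' = k" by simp
qed

unbundle no cross3_syntax

section \<open>The parametrization of a helicoidal surface\<close>

lemma vector_3_axis:
  "vector [a, b, c] = a *\<^sub>R axis 1 1 + b *\<^sub>R axis 2 1 + c *\<^sub>R (axis 3 1 :: real ^ 3)"
  by (simp add: vec_eq_iff forall_3 axis_def)

lemma Ck_on_vector_3:
  assumes "open S" "Ck_on k S a" "Ck_on k S b" "Ck_on k S c"
  shows "Ck_on k S (\<lambda>x. vector [a x, b x, c x] :: real ^ 3)"
  unfolding vector_3_axis
  using assms by (intro Ck_on_add Ck_on_linear_compose[OF bounded_linear_scaleR_left])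

lemma has_derivative_vector_3:
  assumes "(a has_derivative a') F" "(b has_derivative b') F" "(c has_derivative c') F"
  shows "((\<lambda>x. vector [a x, b x, c x] :: real ^ 3) has_derivative (\<lambda>v. vector [a' v, b' v, c' v])) F"
  unfolding vector_3_axis using assms by (intro has_derivative_add has_derivative_scaleR_left)

lemma has_vector_derivative_vector_3:
  assumes "(a has_real_derivative a') (at t)" "(b has_real_derivative b') (at t)"
    "(c has_real_derivative c') (at t)"
  shows "((\<lambda>x. vector [a x, b x, c x] :: real ^ 3) has_vector_derivative vector [a', b', c']) (at t)"
proof -
  have "(\<lambda>v. v *\<^sub>R (vector [a', b', c'] :: real ^ 3)) = (\<lambda>v. vector [a' * v, b' * v, c' * v])"
    by (auto simp: vec_eq_iff forall_3)
  then show ?thesis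
    using has_derivative_vector_3[OF assms[unfolded has_field_derivative_def]]
    by (simp add: has_vector_derivative_def)
qed

definition helicoid_point :: "real \<Rightarrow> (real \<Rightarrow> real) \<Rightarrow> real \<Rightarrow> real \<Rightarrow> real ^ 3" where
  "helicoid_point h f r \<theta> = vector [r * cos \<theta>, r * sin \<theta>, f r + h * \<theta>]"

definition helicoid_dr :: "(real \<Rightarrow> real) \<Rightarrow> real \<Rightarrow> real \<Rightarrow> real ^ 3" where
  "helicoid_dr f' r \<theta> = vector [cos \<theta>, sin \<theta>, f' r]"

definition helicoid_dtheta :: "real \<Rightarrow> real \<Rightarrow> real \<Rightarrow> real ^ 3" where
  "helicoid_dtheta h r \<theta> = vector [- r * sin \<theta>, r * cos \<theta>, h]"

definition helicoid_normal :: "real \<Rightarrow> (real \<Rightarrow> real) \<Rightarrow> real \<Rightarrow> real \<Rightarrow> real ^ 3" where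
  "helicoid_normal h f' r \<theta> =
     vector [h * sin \<theta> - r * f' r * cos \<theta>, - h * cos \<theta> - r * f' r * sin \<theta>, r]"

lemma helicoid_normal_eq_cross:
  includes cross3_syntax
  shows
  "helicoid_dr f' r \<theta> \<times> helicoid_dtheta h r \<theta> = helicoid_normal h f' r \<theta>"
proof -
  have "r * cos \<theta> * cos \<theta> + r * sin \<theta> * sin \<theta> = r"
    using sin_cos_squared_add3[of \<theta>] by (metis distrib_left mult.assoc mult.right_neutral)
  then show ?thesis
    by (simp add: helicoid_dr_def helicoid_dtheta_def helicoid_normal_def cross3_def
        vec_eq_iff forall_3 algebra_simps)
qed

lemma helicoid_normal_norm:
  "helicoid_normal h f' r \<theta> \<bullet> helicoid_normal h f' r \<theta> = r\<^sup>2 + h\<^sup>2 + r\<^sup>2 * (f' r)\<^sup>2"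
  using sin_cos_squared_add[of \<theta>]
  by (simp add: helicoid_normal_def inner_vec_def sum_3 power2_eq_square) algebra

text \<open>
  Stated for coordinates that are functions of a parameter in an arbitrary space, so that it covers both
  the parametrization itself and the curves in the surface.
\<close>

lemma smooth_on_helicoid_point:
  assumes "open S" "open I" "smooth_on I f" "smooth_on S \<rho>" "smooth_on S \<phi>" "\<rho> ` S \<subseteq> I"
  shows "smooth_on S (\<lambda>x. helicoid_point h f (\<rho> x) (\<phi> x))"
  unfolding smooth_on_def helicoid_point_def
proof
  fix k
  have \<rho>: "Ck_on k S \<rho>" and \<phi>: "Ck_on k S \<phi>" and f: "Ck_on k I f"
    using assms by (auto simp: smooth_on_def)
  have sin: "Ck_on k S (\<lambda>x. sin (\<phi> x))" and cos: "Ck_on k S (\<lambda>x. cos (\<phi> x))"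
    using Ck_on_sin_cos[of k] by (auto intro: Ck_on_compose[OF assms(1) \<phi>])
  show "Ck_on k S (\<lambda>x. vector [\<rho> x * cos (\<phi> x), \<rho> x * sin (\<phi> x), f (\<rho> x) + h * \<phi> x] :: real ^ 3)"
    by (intro Ck_on_vector_3 Ck_on_add Ck_on_mult Ck_on_const Ck_on_compose[OF assms(1) \<rho> f]
        assms sin cos \<rho> \<phi>)
qed

lemma helicoid_point_has_vector_derivative:
  assumes f: "(f has_real_derivative f' (\<rho> t)) (at (\<rho> t))"
    and \<rho>: "(\<rho> has_real_derivative \<rho>') (at t)" and \<phi>: "(\<phi> has_real_derivative \<phi>') (at t)"
  shows "((\<lambda>t. helicoid_point h f (\<rho> t) (\<phi> t)) has_vector_derivative
           \<rho>' *\<^sub>R helicoid_dr f' (\<rho> t) (\<phi> t) + \<phi>' *\<^sub>R helicoid_dtheta h (\<rho> t) (\<phi> t)) (at t)"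
proof -
  have f\<rho>: "((\<lambda>t. f (\<rho> t)) has_real_derivative f' (\<rho> t) * \<rho>') (at t)"
    by (rule DERIV_chain2[where f = f and g = \<rho>, OF f \<rho>])
  have "((\<lambda>t. helicoid_point h f (\<rho> t) (\<phi> t)) has_vector_derivative
      vector [\<rho>' * cos (\<phi> t) - \<rho> t * (sin (\<phi> t) * \<phi>'), \<rho>' * sin (\<phi> t) + \<rho> t * (cos (\<phi> t) * \<phi>'),
              f' (\<rho> t) * \<rho>' + h * \<phi>']) (at t)"
    unfolding helicoid_point_def
    by (intro has_vector_derivative_vector_3)
       (auto intro!: derivative_eq_intros \<rho> \<phi> f\<rho> simp: algebra_simps)
  also have "vector [\<rho>' * cos (\<phi> t) - \<rho> t * (sin (\<phi> t) * \<phi>'), \<rho>' * sin (\<phi> t) + \<rho> t * (cos (\<phi> t) * \<phi>'),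
              f' (\<rho> t) * \<rho>' + h * \<phi>']
      = \<rho>' *\<^sub>R helicoid_dr f' (\<rho> t) (\<phi> t) + \<phi>' *\<^sub>R helicoid_dtheta h (\<rho> t) (\<phi> t)"
    by (simp add: helicoid_dr_def helicoid_dtheta_def vec_eq_iff forall_3 algebra_simps)
  finally show ?thesis .
qed

lemma regular_parametrization_helicoid_point:
  assumes "open I" "I \<subseteq> {0<..}" "smooth_on I f"
  shows "regular_parametrization (I \<times> UNIV) (\<lambda>(r, \<theta>). helicoid_point h f r \<theta>)"
proof -
  have "regular_parametrization (I \<times> UNIV) (\<lambda>q. helicoid_point h f (fst q) (snd q))"
    unfolding regular_parametrization_def
  proof (intro conjI ballI)
    show op: "open (I \<times> (UNIV :: real set))"
      using \<open>open I\<close> by (simp add: open_Times)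
    show "smooth_on (I \<times> UNIV) (\<lambda>q. helicoid_point h f (fst q) (snd q))"
      using op assms
      by (intro smooth_on_helicoid_point[where I = I])
         (auto simp: smooth_on_def bounded_linear_fst bounded_linear_snd intro!: Ck_on_bounded_linear)
    obtain f1 where f1: "\<And>t. t \<in> I \<Longrightarrow> (f has_real_derivative f1 t) (at t)"
      using smooth_on_real_derivatives[OF \<open>smooth_on I f\<close>] by metis
    fix q assume q: "q \<in> I \<times> (UNIV :: real set)"
    obtain r \<theta> where q_eq: "q = (r, \<theta>)" by (cases q)
    have r: "r \<in> I" "r > 0" using q assms by (auto simp: q_eq)
    let ?D = "\<lambda>v. fst v *\<^sub>R helicoid_dr f1 r \<theta> + snd v *\<^sub>R helicoid_dtheta h r \<theta>"
    have fst: "((\<lambda>v. fst v) has_derivative fst) (at q)" and snd: "((\<lambda>v. snd v) has_derivative snd) (at q)"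
      by (auto intro: bounded_linear_imp_has_derivative bounded_linear_fst bounded_linear_snd)
    have f: "((\<lambda>v. f (fst v)) has_derivative (\<lambda>v. f1 r * fst v)) (at q)"
      using has_derivative_compose[OF fst, of f "(*) (f1 r)"] f1[OF r(1)]
      by (simp add: q_eq has_field_derivative_def)
    have "((\<lambda>v. helicoid_point h f (fst v) (snd v)) has_derivative
        (\<lambda>v. vector [r * (- sin \<theta> * snd v) + fst v * cos \<theta>, r * (cos \<theta> * snd v) + fst v * sin \<theta>,
                     f1 r * fst v + h * snd v])) (at q)"
      unfolding helicoid_point_def
      by (rule has_derivative_vector_3; (rule derivative_eq_intros fst snd f)+) (auto simp: q_eq)
    also have "(\<lambda>v. vector [r * (- sin \<theta> * snd v) + fst v * cos \<theta>, r * (cos \<theta> * snd v) + fst v * sin \<theta>,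
                     f1 r * fst v + h * snd v]) = ?D"
      by (simp add: helicoid_dr_def helicoid_dtheta_def fun_eq_iff vec_eq_iff forall_3 algebra_simps)
    finally have D: "frechet_derivative (\<lambda>q. helicoid_point h f (fst q) (snd q)) (at q) = ?D"
      by (rule frechet_derivative_at[symmetric])
    have lin: "linear ?D"
      by (auto intro!: linearI simp: algebra_simps)
    show "inj (frechet_derivative (\<lambda>q. helicoid_point h f (fst q) (snd q)) (at q))"
      unfolding D linear_injective_0[OF lin]
    proof (intro allI impI)
      fix v :: "real \<times> real" assume "?D v = 0"
      then have e1: "fst v * cos \<theta> - snd v * r * sin \<theta> = 0"
        and e2: "fst v * sin \<theta> + snd v * r * cos \<theta> = 0"
        by (auto simp: helicoid_dr_def helicoid_dtheta_def vec_eq_iff forall_3 algebra_simps)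
      have sc: "(sin \<theta>)\<^sup>2 + (cos \<theta>)\<^sup>2 = 1" by simp
      have "fst v = 0" using e1 e2 sc by algebra
      moreover have "snd v * r = 0" using e1 e2 sc by algebra
      ultimately show "v = 0" using r by (simp add: prod_eq_iff)
    qed
  qed
  then show ?thesis
    by (simp add: case_prod_beta')
qed

lemma helicoidal_surface_eq_image:
  assumes "helicoidal_surface h I f \<Sigma>"
  shows "\<Sigma> = (\<lambda>(r, \<theta>). helicoid_point h f r \<theta>) ` (I \<times> UNIV)"
proof -
  have motion: "helicoidal_motion h s (vector [r, 0, f r]) = helicoid_point h f r s" for r s
    by (simp add: helicoidal_motion_def helicoid_point_def)
  show ?thesis
  proof
    show "\<Sigma> \<subseteq> (\<lambda>(r, \<theta>). helicoid_point h f r \<theta>) ` (I \<times> UNIV)"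
      using assms unfolding helicoidal_surface_def motion by force
    have "helicoid_point h f r s \<in> \<Sigma>" if "r \<in> I" for r s
    proof -
      have "vector [r, 0, f r] \<in> \<Sigma>" "helicoidal_motion h s ` \<Sigma> = \<Sigma>"
        using assms that unfolding helicoidal_surface_def by auto
      then show ?thesis unfolding motion[symmetric] by blast
    qed
    then show "(\<lambda>(r, \<theta>). helicoid_point h f r \<theta>) ` (I \<times> UNIV) \<subseteq> \<Sigma>"
      by auto
  qed
qed

text \<open>
  The parametrization has a global inverse: the radius is \<open>sqrt (x\<^sup>2 + y\<^sup>2)\<close>, and since the pitch is not
  zero, the height determines the angle, including its multiple of \<open>2\<pi>\<close>.
\<close>

lemma helicoid_point_inverse:
  assumes "h \<noteq> 0" "r > 0" "p = helicoid_point h f r \<theta>"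
  shows "sqrt ((p $ 1)\<^sup>2 + (p $ 2)\<^sup>2) = r" "(p $ 3 - f r) / h = \<theta>"
proof -
  have "(sin \<theta>)\<^sup>2 + (cos \<theta>)\<^sup>2 = 1" by simp
  then have "(p $ 1)\<^sup>2 + (p $ 2)\<^sup>2 = r\<^sup>2"
    unfolding assms(3) helicoid_point_def vector_3 by algebra
  then show "sqrt ((p $ 1)\<^sup>2 + (p $ 2)\<^sup>2) = r"
    using \<open>r > 0\<close> by simp
  show "(p $ 3 - f r) / h = \<theta>"
    using \<open>h \<noteq> 0\<close> by (simp add: assms(3) helicoid_point_def)
qed

lemma has_real_derivative_sqrt:
  assumes "(g has_real_derivative g') (at t)" "g t > 0"
  shows "((\<lambda>s. sqrt (g s)) has_real_derivative inverse (sqrt (g t)) / 2 * g') (at t)"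
  by (rule DERIV_chain2[where f = sqrt and g = g, OF DERIV_real_sqrt[OF assms(2)] assms(1)])

text \<open>
  Lines in the parameter domain give curves in the surface with every velocity in the span of the
  coordinate vectors.  Conversely, the global inverse of the parametrization is differentiable, so that a
  curve in the surface is the image of a curve \<open>(\<rho>, \<phi>)\<close> that is differentiable at the given point.
\<close>

lemma tangent_space_helicoid:
  assumes \<Sigma>: "helicoidal_surface h I f \<Sigma>" and "h \<noteq> 0"
    and I: "open I" "I \<subseteq> {0<..}" and smooth: "smooth_on I f"
    and f1: "\<And>t. t \<in> I \<Longrightarrow> (f has_real_derivative f1 t) (at t)"
    and "r \<in> I"
  shows "tangent_space \<Sigma> (helicoid_point h f r \<theta>) =
           {a *\<^sub>R helicoid_dr f1 r \<theta> + b *\<^sub>R helicoid_dtheta h r \<theta> | a b. True}"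
    (is "?T = ?P")
proof
  show "?P \<subseteq> ?T"
  proof
    fix w assume "w \<in> ?P"
    then obtain a b where w: "w = a *\<^sub>R helicoid_dr f1 r \<theta> + b *\<^sub>R helicoid_dtheta h r \<theta>"
      by blast
    obtain d where "d > 0" and d: "ball r d \<subseteq> I"
      using I \<open>r \<in> I\<close> open_contains_ball by blast
    \<comment> \<open>The summand 1 covers the case \<open>a = 0\<close>.\<close>
    define e where "e = d / (\<bar>a\<bar> + 1)"
    define c where "c t = helicoid_point h f (r + a * t) (\<theta> + b * t)" for t
    have "e > 0" using \<open>d > 0\<close> by (simp add: e_def)
    have in_I: "r + a * t \<in> I" if "t \<in> {-e<..<e}" for t
    proof -
      have "\<bar>a * t\<bar> \<le> \<bar>a\<bar> * e"
        using that by (auto simp: abs_mult intro!: mult_left_mono)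
      also have "\<dots> < (\<bar>a\<bar> + 1) * e" using \<open>e > 0\<close> by simp
      also have "\<dots> = d" by (simp add: e_def)
      finally show ?thesis using d by (auto simp: dist_real_def subset_eq)
    qed
    have affine: "smooth_on {-e<..<e} (\<lambda>t. u + v * t)" for u v :: real
      unfolding smooth_on_def
      by (intro allI Ck_on_add Ck_on_const Ck_on_bounded_linear bounded_linear_mult_right
          open_greaterThanLessThan)
    have "smooth_on {-e<..<e} c"
      unfolding c_def using I smooth in_I affine
      by (intro smooth_on_helicoid_point[where I = I]) auto
    moreover have "c ` {-e<..<e} \<subseteq> \<Sigma>"
      using in_I by (auto simp: c_def helicoidal_surface_eq_image[OF \<Sigma>])
    moreover have "(c has_vector_derivative w) (at 0)"
    proof -
      have "((\<lambda>t. r + a * t) has_real_derivative a) (at 0)"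
        "((\<lambda>t. \<theta> + b * t) has_real_derivative b) (at 0)"
        by (auto intro!: derivative_eq_intros)
      from helicoid_point_has_vector_derivative[where f = f and f' = f1, OF _ this]
      show ?thesis using f1[OF \<open>r \<in> I\<close>] by (simp add: c_def[abs_def] w)
    qed
    moreover have "c 0 = helicoid_point h f r \<theta>" by (simp add: c_def)
    ultimately show "w \<in> ?T"
      unfolding tangent_space_def using \<open>e > 0\<close> by blast
  qed
  show "?T \<subseteq> ?P"
  proof
    fix w assume "w \<in> ?T"
    then obtain c e where "e > 0" and c\<Sigma>: "c ` {-e<..<e} \<subseteq> \<Sigma>"
      and c0: "c 0 = helicoid_point h f r \<theta>" and w: "(c has_vector_derivative w) (at (0::real))"
      unfolding tangent_space_def by blast
    have comp: "((\<lambda>t. c t $ i) has_real_derivative w $ i) (at 0)" for i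
      using bounded_linear.has_vector_derivative[OF bounded_linear_vec_nth w]
      by (simp add: has_real_derivative_iff_has_vector_derivative)
    define \<rho> where "\<rho> t = sqrt ((c t $ 1)\<^sup>2 + (c t $ 2)\<^sup>2)" for t
    define \<phi> where "\<phi> t = (c t $ 3 - f (\<rho> t)) / h" for t
    have "r > 0" using I \<open>r \<in> I\<close> by auto
    have 0: "\<rho> 0 = r" "\<phi> 0 = \<theta>"
      using helicoid_point_inverse[OF \<open>h \<noteq> 0\<close> \<open>r > 0\<close> c0] by (simp_all add: \<rho>_def \<phi>_def)
    \<comment> \<open>The coordinates \<open>\<rho>, \<phi>\<close> of the curve are those of the global inverse.\<close>
    have c_eq: "c t = helicoid_point h f (\<rho> t) (\<phi> t)" if t: "t \<in> {-e<..<e}" for t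
    proof -
      have "c t \<in> \<Sigma>" using c\<Sigma> t by blast
      then obtain s \<psi> where s: "s \<in> I" and ct: "c t = helicoid_point h f s \<psi>"
        unfolding helicoidal_surface_eq_image[OF \<Sigma>] by auto
      have "s > 0" using I s by auto
      show ?thesis
        using helicoid_point_inverse[OF \<open>h \<noteq> 0\<close> \<open>s > 0\<close> ct] ct by (simp add: \<rho>_def \<phi>_def)
    qed
    have pos: "(c 0 $ 1)\<^sup>2 + (c 0 $ 2)\<^sup>2 > 0"
      using 0 \<open>r > 0\<close> unfolding \<rho>_def by (metis real_sqrt_gt_0_iff)
    obtain \<rho>' where \<rho>': "(\<rho> has_real_derivative \<rho>') (at 0)"
      by (rule that, unfold \<rho>_def[abs_def])
         (rule has_real_derivative_sqrt derivative_eq_intros comp refl pos)+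
    have f\<rho>: "((\<lambda>t. f (\<rho> t)) has_real_derivative f1 r * \<rho>') (at 0)"
      by (rule DERIV_chain2[where f = f and g = \<rho>, OF _ \<rho>']) (simp add: 0 f1 \<open>r \<in> I\<close>)
    obtain \<phi>' where \<phi>': "(\<phi> has_real_derivative \<phi>') (at 0)"
      by (rule that, unfold \<phi>_def[abs_def]) (rule derivative_eq_intros comp f\<rho> refl \<open>h \<noteq> 0\<close>)+
    have "((\<lambda>t. helicoid_point h f (\<rho> t) (\<phi> t)) has_vector_derivative
        \<rho>' *\<^sub>R helicoid_dr f1 r \<theta> + \<phi>' *\<^sub>R helicoid_dtheta h r \<theta>) (at 0)"
      using helicoid_point_has_vector_derivative[where f = f and f' = f1, OF _ \<rho>' \<phi>'] 0 f1[OF \<open>r \<in> I\<close>]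
      by simp
    then have "(c has_vector_derivative
        \<rho>' *\<^sub>R helicoid_dr f1 r \<theta> + \<phi>' *\<^sub>R helicoid_dtheta h r \<theta>) (at 0)"
      by (rule has_vector_derivative_transform_within_open[where S = "{-e<..<e}"])
         (use \<open>e > 0\<close> c_eq in auto)
    then have "w = \<rho>' *\<^sub>R helicoid_dr f1 r \<theta> + \<phi>' *\<^sub>R helicoid_dtheta h r \<theta>"
      using w vector_derivative_unique_at by blast
    then show "w \<in> ?P" by blast
  qed
qed

section \<open>The Gauss curvature of a helicoidal surface\<close>

lemma smooth_map_on_imp_has_derivative:
  assumes "smooth_map_on S F" "x \<in> S"
  shows "\<exists>L. (F has_derivative L) (at x within S)"
proof -
  obtain V g where V: "open V" "x \<in> V" "smooth_on V g" "\<forall>y\<in>V \<inter> S. g y = F y"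
    using assms unfolding smooth_map_on_def by blast
  have "Ck_on (Suc 0) V g" using V(3) unfolding smooth_on_def by blast
  then have "(g has_derivative frechet_derivative g (at x)) (at x within S)"
    using Ck_on_SucD V(2) has_derivative_at_withinI by blast
  moreover have "eventually (\<lambda>y. g y = F y) (at x within S)"
    using V eventually_at_topological by blast
  ultimately show ?thesis
    using has_derivative_transform_eventually V(2,4) assms(2) by blast
qed

lemma has_vector_derivative_along_curve:
  assumes F: "(F has_derivative L) (at (c t) within S)" and c: "(c has_vector_derivative w) (at t)"
    and J: "open J" "t \<in> J" "c ` J \<subseteq> S"
  shows "((\<lambda>s. F (c s)) has_vector_derivative L w) (at t)"
proof -
  have "((\<lambda>s. F (c s)) has_derivative (\<lambda>x. L (x *\<^sub>R w))) (at t within J)"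
  proof (rule has_derivative_in_compose[where f = c and g = F])
    show "(c has_derivative (\<lambda>x. x *\<^sub>R w)) (at t within J)"
      using c by (simp add: has_vector_derivative_def has_derivative_at_withinI)
    show "(F has_derivative L) (at (c t) within c ` J)"
      by (rule has_derivative_subset[OF F J(3)])
  qed
  then show ?thesis
    unfolding has_vector_derivative_def linear_cmul[OF has_derivative_linear[OF F]]
      at_within_open[OF J(2,1)] .
qed

lemma derivative_of_unit_vector_orthogonal:
  assumes g: "(g has_vector_derivative y) (at t)" and J: "open J" "t \<in> J" "\<And>s. s \<in> J \<Longrightarrow> norm (g s) = 1"
  shows "y \<bullet> g t = 0"
proof -
  have "((\<lambda>s. g s \<bullet> g s) has_vector_derivative g t \<bullet> y + y \<bullet> g t) (at t)"
    by (rule bounded_bilinear.has_vector_derivative[OF bounded_bilinear_inner g g])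
  moreover have "((\<lambda>s. g s \<bullet> g s) has_vector_derivative 0) (at t)"
    by (rule has_vector_derivative_transform_within_open[OF has_vector_derivative_const J(1,2)])
       (use J(3) in \<open>simp add: dot_square_norm\<close>)
  ultimately show ?thesis
    using vector_derivative_unique_at by (force simp: inner_commute)
qed

lemma nonzero_constant_sign:
  fixes g :: "'a::topological_space \<Rightarrow> real"
  assumes "continuous_on J g" "connected J" "\<And>t. t \<in> J \<Longrightarrow> g t \<noteq> 0"
  shows "(\<forall>t\<in>J. g t > 0) \<or> (\<forall>t\<in>J. g t < 0)"
proof (rule ccontr)
  assume "\<not> ?thesis"
  then obtain s t where "s \<in> J" "g s \<le> 0" "t \<in> J" "0 \<le> g t"
    by (meson not_less)
  moreover have "connected (g ` J)"
    using assms by (intro connected_continuous_image)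
  ultimately have "0 \<in> g ` J"
    using connectedD_interval by blast
  then show False using assms(3) by force
qed

text \<open>
  The sign \<open>\<epsilon>\<close> is the same everywhere: the third component \<open>\<plusminus> r / W\<close> of the normal is continuous and has
  no zero on the connected parameter domain.
\<close>

lemma unit_normal_helicoid:
  assumes \<Sigma>: "helicoidal_surface h I f \<Sigma>" and "h \<noteq> 0"
    and I: "open I" "is_interval I" "I \<subseteq> {0<..}" and smooth: "smooth_on I f"
    and f1: "\<And>t. t \<in> I \<Longrightarrow> (f has_real_derivative f1 t) (at t)"
    and N: "unit_normal_field \<Sigma> N"
  obtains \<epsilon> :: real where "\<epsilon>\<^sup>2 = 1" and
    "\<And>r \<theta>. r \<in> I \<Longrightarrow> N (helicoid_point h f r \<theta>) =
        (\<epsilon> / sqrt (r\<^sup>2 + h\<^sup>2 + r\<^sup>2 * (f1 r)\<^sup>2)) *\<^sub>R helicoid_normal h f1 r \<theta>"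
proof -
  let ?W = "\<lambda>r. sqrt (r\<^sup>2 + h\<^sup>2 + r\<^sup>2 * (f1 r)\<^sup>2)"
  let ?n = "helicoid_normal h f1"
  let ?N = "\<lambda>q. N (helicoid_point h f (fst q) (snd q))"
  have in_\<Sigma>: "helicoid_point h f r \<theta> \<in> \<Sigma>" if "r \<in> I" for r \<theta>
    using that by (auto simp: helicoidal_surface_eq_image[OF \<Sigma>])
  have multiple: "\<exists>t. N (helicoid_point h f r \<theta>) = t *\<^sub>R ?n r \<theta> \<and> (t * ?W r)\<^sup>2 = 1" if "r \<in> I" for r \<theta>
  proof -
    let ?N = "N (helicoid_point h f r \<theta>)"
    let ?a = "helicoid_dr f1 r \<theta>" and ?b = "helicoid_dtheta h r \<theta>"
    have tangent: "tangent_space \<Sigma> (helicoid_point h f r \<theta>) = {a *\<^sub>R ?a + b *\<^sub>R ?b | a b. True}"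
      by (rule tangent_space_helicoid[OF \<Sigma> \<open>h \<noteq> 0\<close> I(1,3) smooth _ that]) (rule f1)
    have "?a = 1 *\<^sub>R ?a + 0 *\<^sub>R ?b" "?b = 0 *\<^sub>R ?a + 1 *\<^sub>R ?b" by auto
    then have "?a \<in> tangent_space \<Sigma> (helicoid_point h f r \<theta>)"
      "?b \<in> tangent_space \<Sigma> (helicoid_point h f r \<theta>)"
      unfolding tangent by blast+
    then have orth: "?N \<bullet> ?a = 0" "?N \<bullet> ?b = 0" and unit: "norm ?N = 1"
      using N in_\<Sigma>[OF that] unfolding unit_normal_field_def by blast+
    have "cross3 (?n r \<theta>) ?N = 0"
      unfolding helicoid_normal_eq_cross[symmetric]
      using orth by (simp add: cross_skew[of _ ?N] Lagrange)
    moreover have "?n r \<theta> \<noteq> 0"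
      using that I by (auto simp: helicoid_normal_def vec_eq_iff forall_3)
    ultimately obtain t where t: "?N = t *\<^sub>R ?n r \<theta>"
      unfolding cross_eq_0 collinear_lemma by (metis scaleR_zero_left)
    have "?n r \<theta> \<bullet> ?n r \<theta> = (?W r)\<^sup>2"
      by (simp add: helicoid_normal_norm)
    then have "?N \<bullet> ?N = (t * ?W r)\<^sup>2"
      unfolding t by (simp add: power2_eq_square)
    moreover have "?N \<bullet> ?N = 1" using unit by (simp add: dot_square_norm)
    ultimately show ?thesis using t by metis
  qed
  have W_pos: "?W r > 0" if "r \<in> I" for r
    using that I by (auto intro!: add_pos_nonneg)
  have N3: "?N q $ 3 \<noteq> 0" if "q \<in> I \<times> UNIV" for q
    using multiple[of "fst q" "snd q"] that subsetD[OF I(3), of "fst q"] by (auto simp: helicoid_normal_def)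
  have "continuous_on \<Sigma> N"
    using N smooth_map_on_imp_has_derivative has_derivative_continuous
    unfolding unit_normal_field_def continuous_on_eq_continuous_within by metis
  moreover have "continuous_on (I \<times> UNIV) (\<lambda>q. helicoid_point h f (fst q) (snd q))"
    using regular_parametrization_helicoid_point[OF I(1,3) smooth, of h]
    unfolding regular_parametrization_def smooth_on_def case_prod_beta' by (metis Ck_on.simps(1))
  ultimately have cont: "continuous_on (I \<times> UNIV) ?N"
    by (rule continuous_on_compose2) (use in_\<Sigma> in auto)
  have "connected (I \<times> (UNIV :: real set))"
    using I(2) by (intro connected_Times) (auto simp: is_interval_connected)
  then have "(\<forall>q \<in> I \<times> UNIV. ?N q $ 3 > 0) \<or> (\<forall>q \<in> I \<times> UNIV. ?N q $ 3 < 0)"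
    by (intro nonzero_constant_sign continuous_intros cont N3)
  then obtain \<epsilon> :: real where \<epsilon>: "\<epsilon>\<^sup>2 = 1" "\<forall>q \<in> I \<times> UNIV. \<epsilon> * ?N q $ 3 > 0"
    by (auto intro: that[of 1] that[of "-1"])
  show thesis
  proof
    fix r \<theta> assume r: "r \<in> I"
    obtain t where t: "N (helicoid_point h f r \<theta>) = t *\<^sub>R ?n r \<theta>" "(t * ?W r)\<^sup>2 = 1"
      using multiple[OF r] by blast
    have "\<epsilon> * (t * r) > 0"
      using \<epsilon>(2)[rule_format, of "(r, \<theta>)"] r t(1) by (simp add: helicoid_normal_def)
    moreover have "r > 0" using r I by auto
    ultimately have "\<epsilon> * t > 0" by (auto simp: zero_less_mult_iff mult_less_0_iff)
    then have "\<epsilon> * (t * ?W r) > 0"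
      using W_pos[OF r] by (simp add: mult.assoc[symmetric] del: real_sqrt_gt_0_iff)
    then have "t * ?W r = \<epsilon>"
      using t(2) \<epsilon>(1) by (auto simp: power2_eq_1_iff)
    then have "t = \<epsilon> / ?W r"
      using W_pos[OF r] by (metis less_irrefl nonzero_eq_divide_eq)
    with t(1) show "N (helicoid_point h f r \<theta>) = (\<epsilon> / ?W r) *\<^sub>R ?n r \<theta>" by simp
  qed (fact \<epsilon>(1))
qed

text \<open>
  The derivative of a unit normal \<open>n / \<parallel>n\<parallel>\<close> contains a multiple of \<open>n\<close> coming from the derivative of the
  length; it does not contribute to the triple product with \<open>n\<close>.
\<close>

lemma cross3_shear_inner:
  "cross3 (a *\<^sub>R x + d *\<^sub>R n) (a *\<^sub>R y) \<bullet> n = a\<^sup>2 * (cross3 x y \<bullet> n)"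
  by (simp add: cross3_def inner_vec_def sum_3) algebra

text \<open>
  By \<open>gauss_curvature_eqI\<close> it suffices to evaluate the triple product of \<open>N\<^sub>r\<close>, \<open>N\<^sub>\<theta>\<close> and
  \<open>n = X\<^sub>r \<times> X\<^sub>\<theta>\<close>, and this is \<open>W\<^sup>-\<^sup>2\<close> times the triple product of \<open>n\<^sub>r\<close>, \<open>n\<^sub>\<theta>\<close> and \<open>n\<close>.
\<close>

lemma gauss_curvature_helicoid:
  assumes \<Sigma>: "helicoidal_surface h I f \<Sigma>" and "h \<noteq> 0"
    and I: "open I" "is_interval I" "I \<subseteq> {0<..}" and smooth: "smooth_on I f"
    and f1: "\<And>t. t \<in> I \<Longrightarrow> (f has_real_derivative f1 t) (at t)"
    and f2: "\<And>t. t \<in> I \<Longrightarrow> (f1 has_real_derivative f2 t) (at t)"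
    and N: "unit_normal_field \<Sigma> N" and "r \<in> I"
  shows "gauss_curvature \<Sigma> N (helicoid_point h f r \<theta>)
           = (r ^ 3 * f1 r * f2 r - h\<^sup>2) / (r\<^sup>2 + h\<^sup>2 + r\<^sup>2 * (f1 r)\<^sup>2)\<^sup>2"
proof -
  define W where "W s = sqrt (s\<^sup>2 + h\<^sup>2 + s\<^sup>2 * (f1 s)\<^sup>2)" for s
  let ?n = "helicoid_normal h f1"
  let ?p = "helicoid_point h f"
  obtain \<epsilon> :: real where "\<epsilon>\<^sup>2 = 1" and N_eq: "\<And>s \<psi>. s \<in> I \<Longrightarrow> N (?p s \<psi>) = (\<epsilon> / W s) *\<^sub>R ?n s \<psi>"
    using unit_normal_helicoid[OF \<Sigma> \<open>h \<noteq> 0\<close> I smooth f1 N] unfolding W_def by metis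
  have "r > 0" using I \<open>r \<in> I\<close> by auto
  then have pos: "r\<^sup>2 + h\<^sup>2 + r\<^sup>2 * (f1 r)\<^sup>2 > 0"
    by (auto intro!: add_pos_nonneg)
  then have "W r > 0" by (simp add: W_def)
  have W2: "(W r)\<^sup>2 = r\<^sup>2 + h\<^sup>2 + r\<^sup>2 * (f1 r)\<^sup>2"
    using pos by (simp add: W_def)
  have in_\<Sigma>: "?p s \<psi> \<in> \<Sigma>" if "s \<in> I" for s \<psi>
    using that by (auto simp: helicoidal_surface_eq_image[OF \<Sigma>])
  have unit: "norm (N (?p s \<psi>)) = 1" if "s \<in> I" for s \<psi>
    using N in_\<Sigma>[OF that] unfolding unit_normal_field_def by blast

  define n_r :: "real ^ 3" where
    "n_r = vector [- (f1 r + r * f2 r) * cos \<theta>, - (f1 r + r * f2 r) * sin \<theta>, 1]"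
  define n_theta :: "real ^ 3" where
    "n_theta = vector [h * cos \<theta> + r * f1 r * sin \<theta>, h * sin \<theta> - r * f1 r * cos \<theta>, 0]"
  have "((\<lambda>s. ?n s \<theta>) has_vector_derivative n_r) (at r)"
    unfolding helicoid_normal_def n_r_def
    by (intro has_vector_derivative_vector_3)
       (auto intro!: derivative_eq_intros f2 \<open>r \<in> I\<close> simp: algebra_simps)
  moreover obtain D where "((\<lambda>s. \<epsilon> / W s) has_real_derivative D) (at r)"
  proof -
    obtain W' where "(W has_real_derivative W') (at r)"
      by (rule that, unfold W_def[abs_def])
         (rule has_real_derivative_sqrt derivative_eq_intros f2[OF \<open>r \<in> I\<close>] refl pos)+
    then show thesis
      using that DERIV_divide[OF DERIV_const] \<open>W r > 0\<close> by (metis less_irrefl)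
  qed
  ultimately have "((\<lambda>s. (\<epsilon> / W s) *\<^sub>R ?n s \<theta>) has_vector_derivative (\<epsilon> / W r) *\<^sub>R n_r + D *\<^sub>R ?n r \<theta>) (at r)"
    by (intro has_vector_derivative_scaleR)
  then have y1: "((\<lambda>s. N (?p s \<theta>)) has_vector_derivative (\<epsilon> / W r) *\<^sub>R n_r + D *\<^sub>R ?n r \<theta>) (at r)"
    by (rule has_vector_derivative_transform_within_open[OF _ \<open>open I\<close> \<open>r \<in> I\<close>]) (simp add: N_eq)
  have "((\<lambda>\<psi>. ?n r \<psi>) has_vector_derivative n_theta) (at \<theta>)"
    unfolding helicoid_normal_def n_theta_def
    by (intro has_vector_derivative_vector_3)
       (auto intro!: derivative_eq_intros simp: algebra_simps)
  then have y2: "((\<lambda>\<psi>. N (?p r \<psi>)) has_vector_derivative (\<epsilon> / W r) *\<^sub>R n_theta) (at \<theta>)"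
    unfolding N_eq[OF \<open>r \<in> I\<close>]
    by (rule bounded_linear.has_vector_derivative[OF bounded_linear_scaleR_right])
  let ?y1 = "(\<epsilon> / W r) *\<^sub>R n_r + D *\<^sub>R ?n r \<theta>" and ?y2 = "(\<epsilon> / W r) *\<^sub>R n_theta"
  let ?K = "(r ^ 3 * f1 r * f2 r - h\<^sup>2) / (r\<^sup>2 + h\<^sup>2 + r\<^sup>2 * (f1 r)\<^sup>2)\<^sup>2"

  have tangent: "tangent_space \<Sigma> (?p r \<theta>) =
      {a *\<^sub>R helicoid_dr f1 r \<theta> + b *\<^sub>R helicoid_dtheta h r \<theta> | a b. True}"
    by (rule tangent_space_helicoid[OF \<Sigma> \<open>h \<noteq> 0\<close> I(1,3) smooth _ \<open>r \<in> I\<close>]) (rule f1)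
  show ?thesis
  proof (rule gauss_curvature_eqI[OF tangent,
        unfolded helicoid_normal_eq_cross, where ?y1.0 = ?y1 and ?y2.0 = ?y2])
    show "?n r \<theta> \<noteq> 0"
      using \<open>r > 0\<close> by (auto simp: helicoid_normal_def vec_eq_iff forall_3)
    show "\<exists>L. (N has_derivative L) (at (?p r \<theta>) within \<Sigma>)"
      using N in_\<Sigma>[OF \<open>r \<in> I\<close>] smooth_map_on_imp_has_derivative unfolding unit_normal_field_def by blast
    show "L (helicoid_dr f1 r \<theta>) = ?y1 \<and> L (helicoid_dtheta h r \<theta>) = ?y2"
      if L: "(N has_derivative L) (at (?p r \<theta>) within \<Sigma>)" for L
    proof
      have "((\<lambda>s. ?p s \<theta>) has_vector_derivative helicoid_dr f1 r \<theta>) (at r)"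
        using helicoid_point_has_vector_derivative[of f f1 "\<lambda>s. s" r 1 "\<lambda>_. \<theta>" 0 h] f1[OF \<open>r \<in> I\<close>]
        by simp
      then have "((\<lambda>s. N (?p s \<theta>)) has_vector_derivative L (helicoid_dr f1 r \<theta>)) (at r)"
        by (rule has_vector_derivative_along_curve[where c = "\<lambda>s. ?p s \<theta>" and J = I, OF L])
           (use I \<open>r \<in> I\<close> in_\<Sigma> in auto)
      with y1 show "L (helicoid_dr f1 r \<theta>) = ?y1"
        using vector_derivative_unique_at by blast
      have "((\<lambda>\<psi>. ?p r \<psi>) has_vector_derivative helicoid_dtheta h r \<theta>) (at \<theta>)"
        using helicoid_point_has_vector_derivative[of f f1 "\<lambda>_. r" \<theta> 0 "\<lambda>s. s" 1 h] f1[OF \<open>r \<in> I\<close>]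
        by simp
      then have "((\<lambda>\<psi>. N (?p r \<psi>)) has_vector_derivative L (helicoid_dtheta h r \<theta>)) (at \<theta>)"
        by (rule has_vector_derivative_along_curve[where c = "\<lambda>\<psi>. ?p r \<psi>" and J = UNIV, OF L])
           (use \<open>r \<in> I\<close> in_\<Sigma> in auto)
      with y2 show "L (helicoid_dtheta h r \<theta>) = ?y2"
        using vector_derivative_unique_at by blast
    qed
    have "\<epsilon> / W r \<noteq> 0" using \<open>\<epsilon>\<^sup>2 = 1\<close> \<open>W r > 0\<close> by auto
    have "?y1 \<bullet> N (?p r \<theta>) = 0"
      by (rule derivative_of_unit_vector_orthogonal[OF y1 \<open>open I\<close> \<open>r \<in> I\<close> unit])
    then show "?y1 \<bullet> ?n r \<theta> = 0"
      unfolding N_eq[OF \<open>r \<in> I\<close>] using \<open>\<epsilon> / W r \<noteq> 0\<close> by simp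
    have "?y2 \<bullet> N (?p r \<theta>) = 0"
      by (rule derivative_of_unit_vector_orthogonal[OF y2 open_UNIV UNIV_I unit[OF \<open>r \<in> I\<close>]])
    then show "?y2 \<bullet> ?n r \<theta> = 0"
      unfolding N_eq[OF \<open>r \<in> I\<close>] using \<open>\<epsilon> / W r \<noteq> 0\<close> by simp
    have sc: "(sin \<theta>)\<^sup>2 + (cos \<theta>)\<^sup>2 = 1" by simp
    have triple: "cross3 n_r n_theta \<bullet> ?n r \<theta> = r ^ 3 * f1 r * f2 r - h\<^sup>2"
      by (simp add: n_r_def n_theta_def helicoid_normal_def cross3_def inner_vec_def sum_3)
         (use sc in algebra)
    have "cross3 ?y1 ?y2 \<bullet> ?n r \<theta> = (\<epsilon> / W r)\<^sup>2 * (cross3 n_r n_theta \<bullet> ?n r \<theta>)"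
      by (rule cross3_shear_inner)
    also have "\<dots> = (r ^ 3 * f1 r * f2 r - h\<^sup>2) / (W r)\<^sup>2"
      using \<open>\<epsilon>\<^sup>2 = 1\<close> by (simp add: triple power_divide)
    also have "\<dots> = ?K * (?n r \<theta> \<bullet> ?n r \<theta>)"
      unfolding helicoid_normal_norm W2 using pos by (simp add: power2_eq_square)
    finally show "cross3 ?y1 ?y2 \<bullet> ?n r \<theta> = ?K * (?n r \<theta> \<bullet> ?n r \<theta>)" .
  qed
qed

section \<open>Real powers of negative numbers\<close>

lemma abs_real_pow: "\<bar>real_pow x a\<bar> = \<bar>x\<bar> powr a"
  by (simp add: real_pow_def)

text \<open>
  Excludes negative curvature for \<open>\<alpha> = 1/2\<close>.
\<close>

lemma not_odd_denominator_half: "\<not> odd_denominator (1 / 2)"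
proof
  assume "odd_denominator (1 / 2)"
  then obtain p q :: int where "odd q" "1 / 2 = real_of_int p / real_of_int q"
    unfolding odd_denominator_def by blast
  moreover from \<open>odd q\<close> have "real_of_int q \<noteq> 0" by auto
  ultimately have "real_of_int q = real_of_int (2 * p)"
    by (simp add: field_simps)
  then have "q = 2 * p" by (simp only: of_int_eq_iff)
  with \<open>odd q\<close> show False by simp
qed

text \<open>
  For \<open>\<alpha> = p / q\<close> the exponent is \<open>2p / (q - 2p)\<close>.
\<close>

lemma odd_denominator_even_numerator:
  assumes "odd_denominator \<alpha>"
  shows "\<exists>p q :: int. even p \<and> odd q \<and> 2 * \<alpha> / (1 - 2 * \<alpha>) = of_int p / of_int q"
proof -
  obtain p q :: int where "odd q" and \<alpha>: "\<alpha> = of_int p / of_int q"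
    using assms unfolding odd_denominator_def by blast
  from \<open>odd q\<close> have "real_of_int q \<noteq> 0" by auto
  then have "2 * \<alpha> / (1 - 2 * \<alpha>) = of_int (2 * p) / of_int (q - 2 * p)"
    unfolding \<alpha> by (simp add: divide_simps)
  moreover have "odd (q - 2 * p)" using \<open>odd q\<close> by simp
  ultimately show ?thesis by (metis dvd_triv_left)
qed

text \<open>
  For \<open>\<delta> = -1\<close> the base is negative, but the exponent \<open>1 / \<beta>\<close> has an even numerator, so the sign of the
  base disappears.
\<close>

lemma real_pow_signed_inverse:
  fixes \<alpha> \<beta> \<delta> u :: real
  assumes "u > 0" "\<alpha> \<noteq> 0" "\<alpha> \<noteq> 1 / 2" and \<beta>: "\<beta> = (1 - 2 * \<alpha>) / (2 * \<alpha>)"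
    and \<delta>: "\<delta> = 1 \<or> \<delta> = -1 \<and> odd_denominator \<alpha>"
  shows "real_pow_defined (\<delta> * u powr \<beta>) (2 * \<alpha> / (1 - 2 * \<alpha>))"
    and "real_pow (\<delta> * u powr \<beta>) (2 * \<alpha> / (1 - 2 * \<alpha>)) = u"
proof -
  have "\<beta> * (2 * \<alpha> / (1 - 2 * \<alpha>)) = 1"
    using assms by (simp add: \<beta>)
  then have inv: "(u powr \<beta>) powr (2 * \<alpha> / (1 - 2 * \<alpha>)) = u"
    using \<open>u > 0\<close> by (simp only: powr_powr powr_one)
  have pos: "u powr \<beta> > 0" using \<open>u > 0\<close> by simp
  show "real_pow_defined (\<delta> * u powr \<beta>) (2 * \<alpha> / (1 - 2 * \<alpha>))"
    using \<delta>
  proof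
    assume "\<delta> = 1" then show ?thesis using pos by (simp add: real_pow_defined_def)
  next
    assume "\<delta> = -1 \<and> odd_denominator \<alpha>"
    then show ?thesis
      using pos odd_denominator_even_numerator unfolding real_pow_defined_def odd_denominator_def
      by fastforce
  qed
  show "real_pow (\<delta> * u powr \<beta>) (2 * \<alpha> / (1 - 2 * \<alpha>)) = u"
    using \<delta>
  proof
    assume "\<delta> = 1" then show ?thesis using inv by (simp add: real_pow_def)
  next
    assume "\<delta> = -1 \<and> odd_denominator \<alpha>"
    then show ?thesis
      using pos odd_denominator_even_numerator inv by (simp add: real_pow_def)
  qed
qed

section \<open>The differential equation of the generating curve\<close>

text \<open>
  Here \<open>u = W\<^sup>2 / t\<^sup>2\<close> with \<open>W\<^sup>2 = t\<^sup>2 + h\<^sup>2 + t\<^sup>2 f'\<^sup>2\<close>; up to the pitch term it is the squared speed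
  \<open>1 + f'\<^sup>2\<close> of the generating curve.  The formula for \<open>K\<close> is \<open>u' = 2 t K u\<^sup>2\<close>, and the translator equation
  expresses \<open>\<bar>K\<bar>\<close> as a power of \<open>u\<close>.
\<close>

lemma speed_ode:
  fixes f1 f2 :: "real \<Rightarrow> real" and h :: real
  defines "u \<equiv> \<lambda>t. 1 + h\<^sup>2 / t\<^sup>2 + (f1 t)\<^sup>2"
  assumes "\<alpha> \<noteq> 0" "t > 0" and f2: "(f1 has_real_derivative f2 t) (at t)"
    and K: "K = (t ^ 3 * f1 t * f2 t - h\<^sup>2) / (t\<^sup>2 + h\<^sup>2 + t\<^sup>2 * (f1 t)\<^sup>2)\<^sup>2"
    and K\<alpha>: "\<bar>K\<bar> powr \<alpha> = t / sqrt (t\<^sup>2 + h\<^sup>2 + t\<^sup>2 * (f1 t)\<^sup>2)"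
  shows "(u has_real_derivative 2 * f1 t * f2 t - 2 * h\<^sup>2 / t ^ 3) (at t)"
    and "2 * f1 t * f2 t - 2 * h\<^sup>2 / t ^ 3 = 2 * t * sgn K * u t powr (2 - 1 / (2 * \<alpha>))"
proof -
  show "(u has_real_derivative 2 * f1 t * f2 t - 2 * h\<^sup>2 / t ^ 3) (at t)"
    unfolding u_def using \<open>t > 0\<close>
    by (auto intro!: derivative_eq_intros f2 simp: field_simps power2_eq_square power3_eq_cube)
  have "u t > 0" unfolding u_def by (auto intro!: add_pos_nonneg)
  have W2: "t\<^sup>2 + h\<^sup>2 + t\<^sup>2 * (f1 t)\<^sup>2 = t\<^sup>2 * u t"
    using \<open>t > 0\<close> by (simp add: u_def field_simps)
  have "sqrt (t\<^sup>2 * u t) = t * sqrt (u t)"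
    using \<open>t > 0\<close> by (simp add: real_sqrt_mult)
  moreover have "u t powr - (1 / 2) = 1 / sqrt (u t)"
    using \<open>u t > 0\<close> by (simp only: powr_minus_divide powr_half_sqrt less_imp_le)
  ultimately have "\<bar>K\<bar> powr \<alpha> = u t powr - (1 / 2)"
    unfolding K\<alpha> W2 using \<open>t > 0\<close> by simp
  then have "(\<bar>K\<bar> powr \<alpha>) powr (1 / \<alpha>) = (u t powr - (1 / 2)) powr (1 / \<alpha>)"
    by simp
  then have absK: "\<bar>K\<bar> = u t powr (- 1 / (2 * \<alpha>))"
    using \<open>\<alpha> \<noteq> 0\<close> by (simp add: powr_powr)
  have "2 * f1 t * f2 t - 2 * h\<^sup>2 / t ^ 3 = 2 * t * (K * (u t)\<^sup>2)"
    unfolding K W2 using \<open>t > 0\<close> \<open>u t > 0\<close> by (simp add: field_simps eval_nat_numeral)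
  also have "\<dots> = 2 * t * (sgn K * (\<bar>K\<bar> * (u t)\<^sup>2))"
    by (simp add: mult.assoc[symmetric] sgn_mult_abs)
  also have "\<bar>K\<bar> * (u t)\<^sup>2 = u t powr (2 - 1 / (2 * \<alpha>))"
  proof -
    have "(u t)\<^sup>2 = u t powr 2" using \<open>u t > 0\<close> by simp
    then have "\<bar>K\<bar> * (u t)\<^sup>2 = u t powr (- 1 / (2 * \<alpha>) + 2)"
      unfolding absK by (simp only: powr_add)
    then show ?thesis by (simp add: algebra_simps)
  qed
  finally show "2 * f1 t * f2 t - 2 * h\<^sup>2 / t ^ 3 = 2 * t * sgn K * u t powr (2 - 1 / (2 * \<alpha>))"
    by (simp add: mult.assoc)
qed

text \<open>
  The exponent \<open>\<beta>\<close> is chosen so that \<open>\<beta> - 1\<close> is opposite to the exponent \<open>2 - 1 / (2\<alpha>)\<close> of the equation: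
  the powers of \<open>u\<close> cancel in the derivative of \<open>u powr \<beta>\<close>.
\<close>

lemma speed_first_integral:
  fixes u :: "real \<Rightarrow> real" and \<alpha> \<delta> :: real
  assumes "is_interval I" and pos: "\<And>t. t \<in> I \<Longrightarrow> u t > 0" and "\<alpha> \<noteq> 0"
    and u: "\<And>t. t \<in> I \<Longrightarrow> (u has_real_derivative 2 * t * \<delta> * u t powr (2 - 1 / (2 * \<alpha>))) (at t)"
  defines "\<beta> \<equiv> (1 - 2 * \<alpha>) / (2 * \<alpha>)"
  obtains c where "\<And>t. t \<in> I \<Longrightarrow> u t powr \<beta> = \<delta> * \<beta> * t\<^sup>2 + c"
proof -
  have "((\<lambda>t. u t powr \<beta> - \<delta> * \<beta> * t\<^sup>2) has_real_derivative 0) (at t within I)" if "t \<in> I" for t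
  proof -
    have "((\<lambda>t. u t powr \<beta>) has_real_derivative
        \<beta> * u t powr (\<beta> - 1) * (2 * t * \<delta> * u t powr (2 - 1 / (2 * \<alpha>)))) (at t)"
      by (rule DERIV_chain2[where f = "\<lambda>x. x powr \<beta>" and g = u,
            OF has_real_derivative_powr[OF pos[OF that]] u[OF that]])
    moreover have "\<beta> - 1 + (2 - 1 / (2 * \<alpha>)) = 0"
      using \<open>\<alpha> \<noteq> 0\<close> by (simp add: \<beta>_def field_simps)
    then have "u t powr (\<beta> - 1) * u t powr (2 - 1 / (2 * \<alpha>)) = 1"
      using pos[OF that] by (simp add: powr_add[symmetric])
    then have "\<beta> * u t powr (\<beta> - 1) * (2 * t * \<delta> * u t powr (2 - 1 / (2 * \<alpha>))) = \<delta> * \<beta> * (2 * t)"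
      by (simp add: algebra_simps)
    ultimately have "((\<lambda>t. u t powr \<beta>) has_real_derivative \<delta> * \<beta> * (2 * t)) (at t)"
      by simp
    moreover have "((\<lambda>t. \<delta> * \<beta> * t\<^sup>2) has_real_derivative \<delta> * \<beta> * (2 * t)) (at t)"
      by (auto intro!: derivative_eq_intros)
    ultimately have "((\<lambda>t. u t powr \<beta> - \<delta> * \<beta> * t\<^sup>2) has_real_derivative
        \<delta> * \<beta> * (2 * t) - \<delta> * \<beta> * (2 * t)) (at t)"
      by (rule DERIV_diff)
    then have "((\<lambda>t. u t powr \<beta> - \<delta> * \<beta> * t\<^sup>2) has_real_derivative 0) (at t)"
      by simp
    then show ?thesis by (rule has_field_derivative_at_within)
  qed
  then have "\<exists>c. \<forall>t\<in>I. u t powr \<beta> - \<delta> * \<beta> * t\<^sup>2 = c"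
    by (rule has_field_derivative_zero_constant[OF is_interval_convex[OF \<open>is_interval I\<close>]])
  then obtain c where "\<forall>t\<in>I. u t powr \<beta> - \<delta> * \<beta> * t\<^sup>2 = c" ..
  then show thesis using that[of c] by (metis add.commute diff_add_cancel)
qed

lemma speed_first_integral_half:
  fixes u :: "real \<Rightarrow> real"
  assumes "is_interval I" and u: "\<And>t. t \<in> I \<Longrightarrow> (u has_real_derivative 2 * t * u t) (at t)"
  obtains m where "\<And>t. t \<in> I \<Longrightarrow> u t = m * exp (t\<^sup>2)"
proof -
  have "((\<lambda>t. u t * exp (- t\<^sup>2)) has_real_derivative 0) (at t within I)" if "t \<in> I" for t
  proof (rule has_field_derivative_at_within)
    show "((\<lambda>t. u t * exp (- t\<^sup>2)) has_real_derivative 0) (at t)"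
      by (auto intro!: derivative_eq_intros u[OF that])
  qed
  then have "\<exists>m. \<forall>t\<in>I. u t * exp (- t\<^sup>2) = m"
    by (rule has_field_derivative_zero_constant[OF is_interval_convex[OF \<open>is_interval I\<close>]])
  then obtain m where m: "\<forall>t\<in>I. u t * exp (- t\<^sup>2) = m" ..
  have "u t = m * exp (t\<^sup>2)" if "t \<in> I" for t
    using m that by (auto simp: exp_minus)
  then show thesis using that by blast
qed

text \<open>
  The equation is that of negative curvature.  At a zero \<open>t\<close> of \<open>f'\<close> its derivative reads
  \<open>f''\<^sup>2 + 2 h\<^sup>2 (2 (t\<^sup>2 + h\<^sup>2) - c h\<^sup>2) / (t\<^sup>4 (t\<^sup>2 + h\<^sup>2)) = 0\<close> with \<open>c = 2 - 1 / (2\<alpha>)\<close>, and \<open>c < 2\<close> because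
  \<open>\<alpha> > 0\<close>.
\<close>

lemma no_horizontal_tangent:
  fixes f1 f2 f3 :: "real \<Rightarrow> real" and h :: real
  defines "u \<equiv> \<lambda>t. 1 + h\<^sup>2 / t\<^sup>2 + (f1 t)\<^sup>2"
  assumes "h \<noteq> 0" "\<alpha> > 0" and I: "open I" "t \<in> I" "t > 0"
    and f2: "(f1 has_real_derivative f2 t) (at t)" and f3: "(f2 has_real_derivative f3 t) (at t)"
    and ode: "\<And>s. s \<in> I \<Longrightarrow> 2 * f1 s * f2 s - 2 * h\<^sup>2 / s ^ 3 = - (2 * s * u s powr (2 - 1 / (2 * \<alpha>)))"
  shows "f1 t \<noteq> 0"
proof
  assume f1: "f1 t = 0"
  define c where "c = 2 - 1 / (2 * \<alpha>)"
  have "c < 2" using \<open>\<alpha> > 0\<close> by (simp add: c_def)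
  have "u t > 0" unfolding u_def by (auto intro!: add_pos_nonneg)
  have u: "(u has_real_derivative - 2 * h\<^sup>2 / t ^ 3) (at t)"
    unfolding u_def using \<open>t > 0\<close> f1
    by (auto intro!: derivative_eq_intros f2 simp: field_simps power2_eq_square power3_eq_cube)
  have uc: "((\<lambda>s. u s powr c) has_real_derivative c * u t powr (c - 1) * (- 2 * h\<^sup>2 / t ^ 3)) (at t)"
    by (rule DERIV_chain2[where f = "\<lambda>x. x powr c" and g = u,
          OF has_real_derivative_powr[OF \<open>u t > 0\<close>] u])
  have "((\<lambda>s. f1 s * f2 s - h\<^sup>2 / s ^ 3 + s * u s powr c) has_real_derivative
      (f2 t)\<^sup>2 + 3 * h\<^sup>2 / t ^ 4 + (u t powr c + t * (c * u t powr (c - 1) * (- 2 * h\<^sup>2 / t ^ 3)))) (at t)"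
  proof -
    have "((\<lambda>s. h\<^sup>2 / s ^ 3) has_real_derivative - (3 * h\<^sup>2 / t ^ 4)) (at t)"
      using \<open>t > 0\<close> by (auto intro!: derivative_eq_intros simp: field_simps eval_nat_numeral)
    from DERIV_add[OF DERIV_diff[OF DERIV_mult[OF f2 f3] this] DERIV_mult[OF DERIV_ident uc]]
    show ?thesis
      by (rule DERIV_cong) (simp add: f1 power2_eq_square)
  qed
  moreover have "((\<lambda>s. f1 s * f2 s - h\<^sup>2 / s ^ 3 + s * u s powr c) has_real_derivative 0) (at t)"
  proof (rule has_field_derivative_transform_within_open[OF DERIV_const I(1,2)])
    show "0 = f1 s * f2 s - h\<^sup>2 / s ^ 3 + s * u s powr c" if "s \<in> I" for s
      using ode[OF that] by (simp add: c_def)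
  qed
  ultimately have eq: "(f2 t)\<^sup>2 + 3 * h\<^sup>2 / t ^ 4
      + (u t powr c + t * (c * u t powr (c - 1) * (- 2 * h\<^sup>2 / t ^ 3))) = 0"
    using DERIV_unique by blast
  have uct: "u t powr c = h\<^sup>2 / t ^ 4"
    using ode[OF I(2)] f1 \<open>t > 0\<close> by (simp add: c_def field_simps eval_nat_numeral)
  have u_eq: "u t = (t\<^sup>2 + h\<^sup>2) / t\<^sup>2"
    using f1 \<open>t > 0\<close> by (simp add: u_def add_divide_distrib)
  have "u t powr (c - 1) = u t powr c / u t"
    using \<open>u t > 0\<close> by (simp only: powr_diff powr_one)
  also have "\<dots> = h\<^sup>2 / (t\<^sup>2 * (t\<^sup>2 + h\<^sup>2))"
    unfolding uct unfolding u_eq using \<open>t > 0\<close> by (simp add: field_simps eval_nat_numeral)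
  finally have uct1: "u t powr (c - 1) = h\<^sup>2 / (t\<^sup>2 * (t\<^sup>2 + h\<^sup>2))" .
  have "t\<^sup>2 + h\<^sup>2 > 0" using \<open>t > 0\<close> by (auto intro!: add_pos_nonneg)
  have "(f2 t)\<^sup>2 + 2 * h\<^sup>2 * (2 * (t\<^sup>2 + h\<^sup>2) - c * h\<^sup>2) / (t ^ 4 * (t\<^sup>2 + h\<^sup>2)) = 0"
  proof -
    have "3 * h\<^sup>2 / t ^ 4 + (h\<^sup>2 / t ^ 4 + t * (c * (h\<^sup>2 / (t\<^sup>2 * q)) * (- 2 * h\<^sup>2 / t ^ 3)))
        = 2 * h\<^sup>2 * (2 * q - c * h\<^sup>2) / (t ^ 4 * q)" if "q > 0" for q
      using that \<open>t > 0\<close> by (simp add: field_simps eval_nat_numeral)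
    from this[OF \<open>t\<^sup>2 + h\<^sup>2 > 0\<close>] eq show ?thesis
      unfolding uct uct1 by linarith
  qed
  moreover have "2 * (t\<^sup>2 + h\<^sup>2) - c * h\<^sup>2 > 0"
  proof -
    have "2 * (t\<^sup>2 + h\<^sup>2) - c * h\<^sup>2 = 2 * t\<^sup>2 + (2 - c) * h\<^sup>2"
      by (simp add: algebra_simps)
    also have "\<dots> > 0"
      using \<open>t > 0\<close> \<open>c < 2\<close> by (intro add_pos_nonneg mult_nonneg_nonneg) auto
    finally show ?thesis .
  qed
  then have "2 * h\<^sup>2 * (2 * (t\<^sup>2 + h\<^sup>2) - c * h\<^sup>2) / (t ^ 4 * (t\<^sup>2 + h\<^sup>2)) > 0"
    using \<open>h \<noteq> 0\<close> \<open>t > 0\<close> \<open>t\<^sup>2 + h\<^sup>2 > 0\<close> by simp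
  ultimately show False using zero_le_power2[of "f2 t"] by linarith
qed

section \<open>Helicoidal translators\<close>

theorem theorem3p2:
  fixes \<alpha> h :: real and I :: "real set" and f :: "real \<Rightarrow> real"
    and \<Sigma> :: "(real ^ 3) set" and N :: "real ^ 3 \<Rightarrow> real ^ 3"
  assumes "\<alpha> \<noteq> 0" and "h \<noteq> 0"
    and "K_translator \<alpha> (vector [0, 0, 1]) \<Sigma> N"
    and "\<not> gauss_curvature \<Sigma> N constant_on \<Sigma>"
    and "open I" and "is_interval I" and "I \<noteq> {}" and "I \<subseteq> {0<..}"
    and "smooth_on I f"
    and "helicoidal_surface h I f \<Sigma>"
  defines "X \<equiv> (\<lambda>(r, \<theta>). vector [r * cos \<theta>, r * sin \<theta>, f r + h * \<theta>] :: real ^ 3)"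
  shows "regular_parametrization (I \<times> UNIV) X \<and> X ` (I \<times> UNIV) = \<Sigma> \<and>
    (\<exists>m \<sigma>.
       (\<alpha> = 1/2 \<longrightarrow> m > 0) \<and>
       (\<alpha> \<noteq> 1/2 \<longrightarrow>
          (\<forall>t\<in>I. real_pow_defined ((1 - 2 * \<alpha>) / (2 * \<alpha>) * t\<^sup>2 + m) (2 * \<alpha> / (1 - 2 * \<alpha>)))) \<and>
       (\<forall>t\<in>I. radicand \<alpha> h m t \<ge> 0) \<and>
       indefinite_integral_on I (\<lambda>t. \<sigma> t * sqrt (radicand \<alpha> h m t)) f \<and>
       sign_choice I (radicand \<alpha> h m) \<sigma> \<and>
       (\<alpha> > 0 \<or> (\<forall>p\<in>\<Sigma>. gauss_curvature \<Sigma> N p > 0) \<longrightarrow> \<sigma> constant_on I))"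
proof -
  note I = \<open>open I\<close> \<open>is_interval I\<close> \<open>I \<subseteq> {0<..}\<close>
  have t_pos: "t > 0" if "t \<in> I" for t using that I by auto
  have X: "X = (\<lambda>(r, \<theta>). helicoid_point h f r \<theta>)"
    by (simp add: X_def helicoid_point_def)
  obtain f1 f2 f3 where
      f1: "\<And>t. t \<in> I \<Longrightarrow> (f has_real_derivative f1 t) (at t)"
    and f2: "\<And>t. t \<in> I \<Longrightarrow> (f1 has_real_derivative f2 t) (at t)"
    and f3: "\<And>t. t \<in> I \<Longrightarrow> (f2 has_real_derivative f3 t) (at t)"
    using smooth_on_real_derivatives[OF \<open>smooth_on I f\<close>] by metis
  have N: "unit_normal_field \<Sigma> N"
    and pow_def: "\<And>p. p \<in> \<Sigma> \<Longrightarrow> real_pow_defined (gauss_curvature \<Sigma> N p) \<alpha>"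
    and pow_eq: "\<And>p. p \<in> \<Sigma> \<Longrightarrow> real_pow (gauss_curvature \<Sigma> N p) \<alpha> = N p \<bullet> vector [0, 0, 1]"
    using \<open>K_translator \<alpha> (vector [0, 0, 1]) \<Sigma> N\<close> unfolding K_translator_def by auto
  have in_\<Sigma>: "helicoid_point h f t 0 \<in> \<Sigma>" if "t \<in> I" for t
    using that by (auto simp: helicoidal_surface_eq_image[OF \<open>helicoidal_surface h I f \<Sigma>\<close>])

  define W where "W t = t\<^sup>2 + h\<^sup>2 + t\<^sup>2 * (f1 t)\<^sup>2" for t
  define K where "K t = (t ^ 3 * f1 t * f2 t - h\<^sup>2) / (W t)\<^sup>2" for t
  define u where "u t = 1 + h\<^sup>2 / t\<^sup>2 + (f1 t)\<^sup>2" for t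
  have W_pos: "W t > 0" if "t \<in> I" for t
    using t_pos[OF that] by (auto simp: W_def intro!: add_pos_nonneg)
  have u_pos: "u t > 0" for t
    unfolding u_def by (auto intro!: add_pos_nonneg)
  have K_eq: "gauss_curvature \<Sigma> N (helicoid_point h f t 0) = K t" if "t \<in> I" for t
    unfolding K_def W_def
    by (rule gauss_curvature_helicoid[OF \<open>helicoidal_surface h I f \<Sigma>\<close> \<open>h \<noteq> 0\<close> I \<open>smooth_on I f\<close>
          f1 f2 N that])
  obtain \<epsilon> :: real where \<epsilon>: "\<epsilon>\<^sup>2 = 1" and
    N_eq: "\<And>r \<theta>. r \<in> I \<Longrightarrow> N (helicoid_point h f r \<theta>) = (\<epsilon> / sqrt (W r)) *\<^sub>R helicoid_normal h f1 r \<theta>"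
    using unit_normal_helicoid[OF \<open>helicoidal_surface h I f \<Sigma>\<close> \<open>h \<noteq> 0\<close> I \<open>smooth_on I f\<close> f1 N]
    unfolding W_def by metis
  \<comment> \<open>Absolute values remove the sign of the normal and the parity in the real power.\<close>
  have K_pow: "\<bar>K t\<bar> powr \<alpha> = t / sqrt (W t)" if "t \<in> I" for t
  proof -
    have "real_pow (K t) \<alpha> = \<epsilon> / sqrt (W t) * t"
      using pow_eq[OF in_\<Sigma>[OF that]] N_eq[OF that]
      by (simp add: K_eq[OF that] helicoid_normal_def inner_vec_def sum_3)
    moreover have "\<bar>\<epsilon>\<bar> = 1" using \<epsilon> by (auto simp: power2_eq_1_iff)
    ultimately show ?thesis
      using abs_real_pow[of "K t" \<alpha>] t_pos[OF that] W_pos[OF that] by (simp add: abs_mult)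
  qed
  have K_nonzero: "K t \<noteq> 0" if "t \<in> I" for t
    using K_pow[OF that] t_pos[OF that] W_pos[OF that] by auto
  have cont: "continuous_on I f1" "continuous_on I f2"
    using DERIV_isCont[OF f2] DERIV_isCont[OF f3] by (auto intro: continuous_at_imp_continuous_on)
  moreover have "(W t)\<^sup>2 \<noteq> 0" if "t \<in> I" for t
    using W_pos[OF that] by simp
  ultimately have "continuous_on I K"
    unfolding K_def[abs_def] W_def by (intro continuous_intros) auto
  then have K_sign: "(\<forall>t\<in>I. K t > 0) \<or> (\<forall>t\<in>I. K t < 0)"
    using nonzero_constant_sign is_interval_connected[OF I(2)] K_nonzero by blast
  have "\<exists>\<delta>. (\<forall>t\<in>I. sgn (K t) = \<delta>) \<and> (\<delta> = 1 \<or> \<delta> = -1 \<and> odd_denominator \<alpha>)"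
    using K_sign
  proof
    assume neg: "\<forall>t\<in>I. K t < 0"
    obtain t where "t \<in> I" using \<open>I \<noteq> {}\<close> by blast
    then have "odd_denominator \<alpha>"
      using pow_def[OF in_\<Sigma>[OF \<open>t \<in> I\<close>]] neg
      unfolding K_eq[OF \<open>t \<in> I\<close>] real_pow_defined_def by force
    with neg show ?thesis by (intro exI[of _ "-1"]) auto
  qed (auto intro!: exI[of _ 1])
  then obtain \<delta> where \<delta>: "\<And>t. t \<in> I \<Longrightarrow> sgn (K t) = \<delta>" "\<delta> = 1 \<or> \<delta> = -1 \<and> odd_denominator \<alpha>"
    by blast
  have ode: "(u has_real_derivative 2 * t * \<delta> * u t powr (2 - 1 / (2 * \<alpha>))) (at t)"
    and ode': "2 * f1 t * f2 t - 2 * h\<^sup>2 / t ^ 3 = 2 * t * \<delta> * u t powr (2 - 1 / (2 * \<alpha>))"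
    if "t \<in> I" for t
    using speed_ode[where ?f1.0 = f1 and ?f2.0 = f2 and t = t and K = "K t",
        OF \<open>\<alpha> \<noteq> 0\<close> t_pos[OF that] f2[OF that] K_def[unfolded W_def] K_pow[OF that, unfolded W_def]]
    unfolding u_def[abs_def] \<delta>(1)[OF that] by simp_all

  have "\<exists>m. (\<alpha> = 1/2 \<longrightarrow> m > 0) \<and>
       (\<alpha> \<noteq> 1/2 \<longrightarrow>
          (\<forall>t\<in>I. real_pow_defined ((1 - 2 * \<alpha>) / (2 * \<alpha>) * t\<^sup>2 + m) (2 * \<alpha> / (1 - 2 * \<alpha>)))) \<and>
       (\<forall>t\<in>I. radicand \<alpha> h m t = (f1 t)\<^sup>2)"
  proof (cases "\<alpha> = 1 / 2")
    case True
    then have "\<delta> = 1" using \<delta>(2) not_odd_denominator_half by metis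
    then have "(u has_real_derivative 2 * t * u t) (at t)" if "t \<in> I" for t
      using ode[OF that] u_pos[of t] by (simp add: True)
    then obtain m where m: "\<And>t. t \<in> I \<Longrightarrow> u t = m * exp (t\<^sup>2)"
      using speed_first_integral_half[OF I(2)] by metis
    obtain t where "t \<in> I" using \<open>I \<noteq> {}\<close> by blast
    with m[of t] u_pos[of t] have "m > 0" by (simp add: zero_less_mult_iff)
    moreover have "radicand \<alpha> h m t = (f1 t)\<^sup>2" if "t \<in> I" for t
      using m[OF that] by (simp add: radicand_def True u_def)
    ultimately show ?thesis using True by blast
  next
    case False
    define \<beta> where "\<beta> = (1 - 2 * \<alpha>) / (2 * \<alpha>)"
    obtain c where c: "\<And>t. t \<in> I \<Longrightarrow> u t powr \<beta> = \<delta> * \<beta> * t\<^sup>2 + c"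
      using speed_first_integral[OF I(2) u_pos \<open>\<alpha> \<noteq> 0\<close> ode] unfolding \<beta>_def by metis
    \<comment> \<open>The constant of integration is \<open>m = \<delta> c\<close>, because \<open>\<delta>\<^sup>2 = 1\<close>.\<close>
    have base: "\<beta> * t\<^sup>2 + \<delta> * c = \<delta> * u t powr \<beta>" if "t \<in> I" for t
      unfolding c[OF that] using \<delta>(2) by auto
    have "real_pow_defined (\<beta> * t\<^sup>2 + \<delta> * c) (2 * \<alpha> / (1 - 2 * \<alpha>))"
      and "real_pow (\<beta> * t\<^sup>2 + \<delta> * c) (2 * \<alpha> / (1 - 2 * \<alpha>)) = u t" if "t \<in> I" for t
      unfolding base[OF that]
      using real_pow_signed_inverse[OF u_pos \<open>\<alpha> \<noteq> 0\<close> False \<beta>_def \<delta>(2)] by blast+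
    then show ?thesis
      using False by (intro exI[of _ "\<delta> * c"]) (simp add: radicand_def u_def flip: \<beta>_def)
  qed
  then obtain m where m: "\<alpha> = 1/2 \<longrightarrow> m > 0"
      "\<alpha> \<noteq> 1/2 \<longrightarrow>
          (\<forall>t\<in>I. real_pow_defined ((1 - 2 * \<alpha>) / (2 * \<alpha>) * t\<^sup>2 + m) (2 * \<alpha> / (1 - 2 * \<alpha>)))"
    and R: "\<And>t. t \<in> I \<Longrightarrow> radicand \<alpha> h m t = (f1 t)\<^sup>2"
    by blast

  \<comment> \<open>The value of the sign at the zeros of \<open>f'\<close> is arbitrary, as the radicand vanishes there.\<close>
  define \<sigma> :: "real \<Rightarrow> real" where "\<sigma> t = (if f1 t \<ge> 0 then 1 else -1)" for t
  have \<sigma>_const: "\<sigma> constant_on J" if "J \<subseteq> I" "is_interval J" "\<And>t. t \<in> J \<Longrightarrow> f1 t \<noteq> 0" for J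
  proof -
    have "(\<forall>t\<in>J. f1 t > 0) \<or> (\<forall>t\<in>J. f1 t < 0)"
      using nonzero_constant_sign that continuous_on_subset[OF cont(1)] is_interval_connected by blast
    then have "(\<forall>t\<in>J. \<sigma> t = 1) \<or> (\<forall>t\<in>J. \<sigma> t = -1)"
      by (force simp: \<sigma>_def)
    then show ?thesis
      unfolding constant_on_def by blast
  qed
  have "indefinite_integral_on I (\<lambda>t. \<sigma> t * sqrt (radicand \<alpha> h m t)) f"
    unfolding indefinite_integral_on_def
  proof
    fix t assume "t \<in> I"
    then have "\<sigma> t * sqrt (radicand \<alpha> h m t) = f1 t"
      by (simp add: R \<sigma>_def)
    with f1[OF \<open>t \<in> I\<close>] show "(f has_real_derivative \<sigma> t * sqrt (radicand \<alpha> h m t)) (at t)"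
      by simp
  qed
  moreover have "sign_choice I (radicand \<alpha> h m) \<sigma>"
    unfolding sign_choice_def
  proof (intro conjI allI impI ballI)
    fix J assume J: "J \<subseteq> I" "is_interval J \<and> (\<forall>t\<in>J. radicand \<alpha> h m t > 0)"
    then show "\<sigma> constant_on J"
      using R by (intro \<sigma>_const) fastforce+
  qed (simp add: \<sigma>_def)
  moreover have "\<sigma> constant_on I" if "\<alpha> > 0 \<or> (\<forall>p\<in>\<Sigma>. gauss_curvature \<Sigma> N p > 0)"
  proof (rule \<sigma>_const)
    fix t assume "t \<in> I"
    show "f1 t \<noteq> 0"
    proof (cases "K t > 0")
      case True
      then show ?thesis
        using W_pos[OF \<open>t \<in> I\<close>] by (auto simp: K_def zero_less_divide_iff)
    next
      case False
      then have "\<alpha> > 0" using that in_\<Sigma>[OF \<open>t \<in> I\<close>] K_eq[OF \<open>t \<in> I\<close>] by auto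
      have "\<delta> = -1" using False K_nonzero[OF \<open>t \<in> I\<close>] \<delta>(1)[OF \<open>t \<in> I\<close>] by (auto simp: sgn_if)
      then show ?thesis
        using no_horizontal_tangent[where ?f1.0 = f1 and ?f2.0 = f2 and ?f3.0 = f3 and t = t and h = h and I = I,
            OF \<open>h \<noteq> 0\<close> \<open>\<alpha> > 0\<close> I(1) \<open>t \<in> I\<close> t_pos[OF \<open>t \<in> I\<close>] f2[OF \<open>t \<in> I\<close>] f3[OF \<open>t \<in> I\<close>]]
          ode' unfolding u_def by simp
    qed
  qed (use I in auto)
  moreover have "regular_parametrization (I \<times> UNIV) X"
    unfolding X by (rule regular_parametrization_helicoid_point[OF I(1,3) \<open>smooth_on I f\<close>])
  moreover have "X ` (I \<times> UNIV) = \<Sigma>"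
    unfolding X using helicoidal_surface_eq_image[OF \<open>helicoidal_surface h I f \<Sigma>\<close>] by simp
  moreover have "\<forall>t\<in>I. radicand \<alpha> h m t \<ge> 0"
    by (simp add: R)
  ultimately show ?thesis
    using m by blast
qed

end
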